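(* Let $1<p<\infty$, let $T\in\mathcal L(\ell_p)$ and let $\lambda\in\operatorname{Int}W_e(T)$. Then for every sequence $(\varepsilon_n)_{n\in\mathbb N}\subset(0,\infty)$ there exists a biorthogonal system $(x_n,x_n^* )\in\ell_p\times\ell_q$ $(n\in\mathbb N)$ such that $$\|x_n\|=1,\qquad \|x_n^*\|<1+\varepsilon_n,\qquad \langle x_n,x_m^*\rangle=\delta_{n,m},\qquad \langle Tx_n,x_m^*\rangle=\lambda\,\delta_{n,m}$$ for all $m,n\in\mathbb N$.
   Context: $\ell_p=\ell_p(\mathbb N)$ is the complex sequence space and $\mathcal L(\ell_p)$ its algebra of bounded linear operators; $\operatorname{Int}$ denotes the interior in $\mathbb C$ and $\delta_{n,m}$ is the Kronecker delta. With $1/p+1/q=1$, the dual $(\ell_p)^*$ is identified with $\ell_q$ via $\langle x,y\rangle=\sum_j x_j\overline{y_j}$. For $x=(x_j)\in\ell_p$ put $J(x)=(x_j|x_j|^{p-2})_j\in\ell_q$ (with $0$ in the coordinates where $x_j=0$). The essential numerical range $W_e(T)$ is the set of all $\lambda\in\mathbb C$ for which there is a net (equivalently, a sequence) of unit vectors $x_\alpha\in\ell_p$ with $x_\alpha\to0$ weakly and $\langle Tx_\alpha,J(x_\alpha)\rangle\to\lambda$. *)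

theory Defs
  imports "HOL-Analysis.Analysis"
begin

text \<open>The space \<open>\<ell>\<^sub>p = \<ell>\<^sub>p(\<nat>)\<close> depends on a real parameter \<open>p\<close>, so it is a set of
  complex sequences (with pointwise operations) and not a type.\<close>

definition lp :: "real \<Rightarrow> (nat \<Rightarrow> complex) set" where
  "lp p = {x. summable (\<lambda>j. cmod (x j) powr p)}"

definition lp_norm :: "real \<Rightarrow> (nat \<Rightarrow> complex) \<Rightarrow> real" where
  "lp_norm p x = (\<Sum>j. cmod (x j) powr p) powr (1 / p)"

text \<open>The pairing is conjugate-linear in its second argument. For \<open>x \<in> lp p\<close>, \<open>y \<in> lp q\<close> with
  \<open>1/p + 1/q = 1\<close> the series converges absolutely by Hoelder's inequality.\<close>

definition lp_pairing :: "(nat \<Rightarrow> complex) \<Rightarrow> (nat \<Rightarrow> complex) \<Rightarrow> complex" where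
  "lp_pairing x y = (\<Sum>j. x j * cnj (y j))"

text \<open>Only the values of \<open>T\<close> on \<open>lp p\<close> matter; outside \<open>lp p\<close> it is arbitrary.\<close>

definition lp_bounded_operator :: "real \<Rightarrow> ((nat \<Rightarrow> complex) \<Rightarrow> (nat \<Rightarrow> complex)) \<Rightarrow> bool" where
  "lp_bounded_operator p T \<longleftrightarrow>
     (\<forall>x\<in>lp p. T x \<in> lp p) \<and>
     (\<forall>x\<in>lp p. \<forall>y\<in>lp p. T (\<lambda>j. x j + y j) = (\<lambda>j. T x j + T y j)) \<and>
     (\<forall>c. \<forall>x\<in>lp p. T (\<lambda>j. c * x j) = (\<lambda>j. c * T x j)) \<and>
     (\<exists>C. \<forall>x\<in>lp p. lp_norm p (T x) \<le> C * lp_norm p x)"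

text \<open>In the coordinates where \<open>x j = 0\<close> this is \<open>0\<close>, also for \<open>p \<le> 2\<close>.\<close>

definition lp_duality_map :: "real \<Rightarrow> (nat \<Rightarrow> complex) \<Rightarrow> (nat \<Rightarrow> complex)" where
  "lp_duality_map p x = (\<lambda>j. x j * complex_of_real (cmod (x j) powr (p - 2)))"

text \<open>Weak convergence to \<open>0\<close> in \<open>lp p\<close>, where the dual is identified with \<open>lp q\<close> through
  \<^const>\<open>lp_pairing\<close>; \<open>q\<close> is meant to be the conjugate exponent of \<open>p\<close>.\<close>

definition lp_weakly_null :: "real \<Rightarrow> (nat \<Rightarrow> nat \<Rightarrow> complex) \<Rightarrow> bool" where
  "lp_weakly_null q u \<longleftrightarrow> (\<forall>y\<in>lp q. (\<lambda>k. lp_pairing (u k) y) \<longlonglongrightarrow> 0)"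

text \<open>The definition uses sequences. Nets give the same set, since bounded subsets of
  \<open>\<ell>\<^sub>p\<close> are weakly metrizable for \<open>1 < p < \<infinity>\<close>.\<close>

definition essential_numerical_range ::
  "real \<Rightarrow> real \<Rightarrow> ((nat \<Rightarrow> complex) \<Rightarrow> (nat \<Rightarrow> complex)) \<Rightarrow> complex set" where
  "essential_numerical_range p q T =
     {l. \<exists>u. (\<forall>k. u k \<in> lp p \<and> lp_norm p (u k) = 1) \<and> lp_weakly_null q u \<and>
            (\<lambda>k. lp_pairing (T (u k)) (lp_duality_map p (u k))) \<longlonglongrightarrow> l}"

end

theory Submission
  imports Defs
begin

text \<open>
  Take three points of the essential numerical range around \<open>l\<close>, the vertices of a triangle with \<open>l\<close> in
  its interior. Each vertex is a limit of values \<open>\<langle>T u, J u\<rangle>\<close> along a weakly null sequence of unit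
  vectors \<open>u\<close>. Far out in such a sequence, \<open>u\<close> and \<open>J u\<close> almost satisfy any finite set of linear
  conditions, so small perturbations satisfy them exactly and have finite support beyond any
  given coordinate (\<open>finitely_supported_perturbation_in_kernels\<close>). Choosing pairs one after
  another (\<open>finitely_supported_dual_pair\<close>, \<open>approximately_diagonal_system\<close>) yields disjointly supported
  pairs \<open>(u\<^sub>k, v\<^sub>k)\<close> with \<open>\<langle>u\<^sub>k, v\<^sub>k\<rangle> = 1\<close>, with \<open>\<langle>T u\<^sub>i, v\<^sub>k\<rangle> = 0\<close> for \<open>i \<noteq> k\<close>, and with
  \<open>\<langle>T u\<^sub>k, v\<^sub>k\<rangle>\<close> as close as desired to the vertices, in periodic order.

  Only the diagonal values are inexact. Group the pairs in consecutive triples. The three values of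
  a triple are near the vertices of the triangle, so \<open>l\<close> is still a convex combination of
  them, with some weights \<open>t\<^sub>i\<close> (\<open>barycentric_coordinates\<close>). Put
  \<open>x = \<Sum>\<^sub>i t\<^sub>i powr (1/p) u\<^sub>i\<close> and \<open>x' = \<Sum>\<^sub>i t\<^sub>i powr (1/q) v\<^sub>i\<close>, summed over the triple. Because
  the supports are disjoint, \<open>x\<close> has norm one and the norm of \<open>x'\<close> is at most the largest norm of the
  \<open>v\<^sub>i\<close>. Because the off-diagonal entries vanish and \<open>1/p + 1/q = 1\<close>, the pairings
  \<open>\<langle>x, x'\<rangle>\<close> and \<open>\<langle>T x, x'\<rangle>\<close> are the convex combinations of the diagonal values, that is \<open>1\<close> and \<open>l\<close>
  exactly, and different triples do not interact.
\<close>

section \<open>The normed space \<open>\<ell>\<^sub>p\<close>\<close>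

lemma lp_norm_nonneg [simp]: "0 \<le> lp_norm p x"
  by (simp add: lp_norm_def)

lemma lp_norm_powr:
  assumes "0 < p" "x \<in> lp p"
  shows "lp_norm p x powr p = (\<Sum>j. cmod (x j) powr p)"
  using assms by (auto simp: lp_norm_def lp_def powr_powr intro!: abs_of_nonneg suminf_nonneg)

text \<open>For membership in \<^term>\<open>lp p\<close> and for norm estimates at once: a termwise majorant
  whose sum is at most \<open>c powr p\<close> settles both.\<close>

lemma lp_bound:
  assumes "0 < p" and le: "\<And>j. cmod (z j) powr p \<le> f j" and f: "f sums S"
    and S: "S \<le> c powr p" and "0 \<le> c"
  shows "z \<in> lp p" and "lp_norm p z \<le> c"
proof -
  show z: "z \<in> lp p"
    unfolding lp_def using le sums_summable[OF f]
    by (auto intro!: summable_comparison_test'[where N = 0 and g = f])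
  have "(\<Sum>j. cmod (z j) powr p) \<le> suminf f"
    using z sums_summable[OF f] by (intro suminf_le le) (auto simp: lp_def)
  then have "(\<Sum>j. cmod (z j) powr p) \<le> S"
    using sums_unique[OF f] by simp
  then have "(\<Sum>j. cmod (z j) powr p) \<le> c powr p" using S by linarith
  moreover have "0 \<le> (\<Sum>j. cmod (z j) powr p)"
    using z by (auto simp: lp_def intro!: suminf_nonneg)
  ultimately have "lp_norm p z \<le> (c powr p) powr (1 / p)"
    unfolding lp_norm_def using \<open>0 < p\<close> by (intro powr_mono2) auto
  then show "lp_norm p z \<le> c" using \<open>0 < p\<close> \<open>0 \<le> c\<close> by (simp add: powr_powr)
qed

lemma lp_coordinate_le_norm:
  assumes "0 < p" "x \<in> lp p"
  shows "cmod (x j) \<le> lp_norm p x"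
proof -
  have "(\<Sum>i\<in>{j}. cmod (x i) powr p) \<le> (\<Sum>i. cmod (x i) powr p)"
    using assms by (intro sum_le_suminf) (auto simp: lp_def)
  then have "(cmod (x j) powr p) powr (1 / p) \<le> lp_norm p x"
    unfolding lp_norm_def using \<open>0 < p\<close> by (intro powr_mono2) auto
  then show ?thesis using \<open>0 < p\<close> by (simp add: powr_powr)
qed

lemma lp_zero [simp]: "(\<lambda>j. 0) \<in> lp p"
  by (simp add: lp_def)

lemma lp_norm_zero [simp]: "0 < p \<Longrightarrow> lp_norm p (\<lambda>j. 0) = 0"
  by (simp add: lp_norm_def)

lemma lp_norm_eq_0_iff:
  assumes "0 < p" "x \<in> lp p"
  shows "lp_norm p x = 0 \<longleftrightarrow> x = (\<lambda>j. 0)"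
proof
  assume "lp_norm p x = 0"
  then have "x j = 0" for j using lp_coordinate_le_norm[OF assms, of j] by simp
  then show "x = (\<lambda>j. 0)" by blast
qed (use assms in simp)

lemma
  assumes "0 < p" "x \<in> lp p"
  shows lp_scale: "(\<lambda>j. c * x j) \<in> lp p"
    and lp_norm_scale: "lp_norm p (\<lambda>j. c * x j) = cmod c * lp_norm p x"
proof -
  have s: "summable (\<lambda>j. cmod (x j) powr p)" using assms by (simp add: lp_def)
  show "(\<lambda>j. c * x j) \<in> lp p"
    unfolding lp_def using s by (auto simp: norm_mult powr_mult intro: summable_mult)
  show "lp_norm p (\<lambda>j. c * x j) = cmod c * lp_norm p x"
  proof -
    have "(\<Sum>j. cmod (c * x j) powr p) = cmod c powr p * (\<Sum>j. cmod (x j) powr p)"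
      using s by (simp add: norm_mult powr_mult suminf_mult)
    then show ?thesis
      using assms(1) by (simp add: lp_norm_def powr_mult powr_powr)
  qed
qed

text \<open>Convexity of \<open>x powr p\<close> on the closed half-line. The boundary matters, since coordinates of
  sequences vanish; there the claim reduces to \<open>c powr p \<le> c\<close> for \<open>0 \<le> c \<le> 1\<close>.\<close>

lemma powr_convex_nonneg:
  fixes a b s t p :: real
  assumes "1 \<le> p" "0 \<le> a" "0 \<le> b" "a + b = 1" "0 \<le> s" "0 \<le> t"
  shows "(a * s + b * t) powr p \<le> a * s powr p + b * t powr p"
proof -
  have *: "(c * r) powr p \<le> c * r powr p" if "0 \<le> c" "c \<le> 1" "0 \<le> r" for c r :: real
  proof -
    have "c powr p \<le> c"
      using that assms(1) powr_mono'[of 1 p c] by (cases "c = 0") auto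
    then show ?thesis using that by (simp add: powr_mult mult_right_mono)
  qed
  show ?thesis
  proof (cases "s = 0 \<or> t = 0")
    case True
    then show ?thesis using *[of a s] *[of b t] assms by auto
  next
    case False
    then have "0 < s" "0 < t" using assms by auto
    moreover have a: "a = 1 - b" using \<open>a + b = 1\<close> by linarith
    ultimately show ?thesis
      using convex_onD[OF powr_convex[OF assms(1)], of b s t] \<open>0 \<le> b\<close> \<open>0 \<le> a\<close>
      unfolding a by simp
  qed
qed

text \<open>Minkowski's inequality. Scaled to norm one, \<open>x / A\<close> and \<open>y / B\<close> enter \<open>(x + y) / (A + B)\<close> with
  convex weights \<open>A / (A + B)\<close> and \<open>B / (A + B)\<close>, so convexity applies in each coordinate.\<close>

lemma
  assumes "1 \<le> p" and x: "x \<in> lp p" and y: "y \<in> lp p"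
  shows lp_add: "(\<lambda>j. x j + y j) \<in> lp p"
    and lp_norm_triangle: "lp_norm p (\<lambda>j. x j + y j) \<le> lp_norm p x + lp_norm p y"
proof -
  define A B where "A = lp_norm p x" and "B = lp_norm p y"
  have p: "0 < p" using assms by simp
  have "(\<lambda>j. x j + y j) \<in> lp p \<and> lp_norm p (\<lambda>j. x j + y j) \<le> A + B"
  proof (cases "A = 0 \<or> B = 0")
    case True
    then show ?thesis using x y p by (auto simp: A_def B_def lp_norm_eq_0_iff)
  next
    case False
    then have AB: "0 < A" "0 < B" using lp_norm_nonneg by (auto simp: A_def B_def less_le)
    define f where "f j = (A + B) powr p * (A / (A + B) * (cmod (x j) powr p / A powr p)
       + B / (A + B) * (cmod (y j) powr p / B powr p))" for j
    have *: "cmod (x j + y j) powr p \<le> f j" for j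
    proof -
      have "cmod (x j + y j) \<le> (A + B) * (A / (A + B) * (cmod (x j) / A) + B / (A + B) * (cmod (y j) / B))"
        using AB norm_triangle_ineq[of "x j" "y j"] by (simp add: distrib_left)
      then have "cmod (x j + y j) powr p \<le>
          ((A + B) * (A / (A + B) * (cmod (x j) / A) + B / (A + B) * (cmod (y j) / B))) powr p"
        using p by (intro powr_mono2) auto
      also have "\<dots> = (A + B) powr p * (A / (A + B) * (cmod (x j) / A) + B / (A + B) * (cmod (y j) / B)) powr p"
        using AB by (intro powr_mult)
      also have "\<dots> \<le> (A + B) powr p * (A / (A + B) * (cmod (x j) / A) powr p + B / (A + B) * (cmod (y j) / B) powr p)"
        using AB assms(1) by (intro mult_left_mono powr_convex_nonneg) (auto simp flip: add_divide_distrib)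
      also have "\<dots> = f j" using AB by (simp add: f_def powr_divide)
      finally show ?thesis .
    qed
    have sx: "(\<lambda>j. cmod (x j) powr p) sums (A powr p)" and sy: "(\<lambda>j. cmod (y j) powr p) sums (B powr p)"
      using x y p by (auto simp: A_def B_def lp_norm_powr lp_def summable_sums)
    have "f sums ((A + B) powr p * (A / (A + B) * (A powr p / A powr p)
       + B / (A + B) * (B powr p / B powr p)))"
      unfolding f_def by (intro sums_mult sums_add sums_divide sx sy)
    also have "(A + B) powr p * (A / (A + B) * (A powr p / A powr p)
       + B / (A + B) * (B powr p / B powr p)) = (A + B) powr p"
      using AB by (simp flip: add_divide_distrib)
    finally have f: "f sums ((A + B) powr p)" .
    then show ?thesis using lp_bound[OF p * f order_refl] AB by simp
  qed
  then show "(\<lambda>j. x j + y j) \<in> lp p" "lp_norm p (\<lambda>j. x j + y j) \<le> lp_norm p x + lp_norm p y"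
    by (auto simp: A_def B_def)
qed

lemma lp_diff:
  assumes "1 \<le> p" "x \<in> lp p" "y \<in> lp p"
  shows "(\<lambda>j. x j - y j) \<in> lp p"
  using lp_add[OF assms(1,2) lp_scale[of p y "-1"]] assms by simp

lemma lp_norm_minus_commute: "lp_norm p (\<lambda>j. x j - y j) = lp_norm p (\<lambda>j. y j - x j)"
  by (simp add: lp_norm_def norm_minus_commute)

lemma lp_norm_diff_triangle:
  assumes "1 \<le> p" "x \<in> lp p" "y \<in> lp p"
  shows "lp_norm p (\<lambda>j. x j - y j) \<le> lp_norm p x + lp_norm p y"
  using lp_norm_triangle[OF assms(1,2) lp_scale[of p y "-1"]] lp_norm_scale[of p y "-1"] assms by simp

lemma abs_lp_norm_diff_le:
  assumes "1 \<le> p" "x \<in> lp p" "y \<in> lp p"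
  shows "\<bar>lp_norm p x - lp_norm p y\<bar> \<le> lp_norm p (\<lambda>j. x j - y j)"
proof -
  have "lp_norm p x \<le> lp_norm p (\<lambda>j. x j - y j) + lp_norm p y"
    using lp_norm_triangle[OF assms(1) lp_diff[OF assms] assms(3)] by simp
  moreover have "lp_norm p y \<le> lp_norm p (\<lambda>j. y j - x j) + lp_norm p x"
    using lp_norm_triangle[OF assms(1) lp_diff[OF assms(1,3,2)] assms(2)] by simp
  ultimately show ?thesis using lp_norm_minus_commute[of p x y] by linarith
qed

section \<open>The pairing of \<open>\<ell>\<^sub>p\<close> and \<open>\<ell>\<^sub>q\<close>\<close>

definition conjugate_exponents :: "real \<Rightarrow> real \<Rightarrow> bool" where
  "conjugate_exponents p q \<longleftrightarrow> 1 < p \<and> 1 < q \<and> 1 / p + 1 / q = 1"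

lemma conjugate_exponentsI:
  assumes "1 < p" "1 / p + 1 / q = 1"
  shows "conjugate_exponents p q"
proof -
  have q: "1 / q = 1 - 1 / p" using assms by linarith
  have "0 < 1 - 1 / p" "1 - 1 / p < 1" using assms(1) by auto
  then have "0 < 1 / q" "1 / q < 1" using q by linarith+
  then have "1 < q" by (simp add: field_simps split: if_splits)
  then show ?thesis using assms by (simp add: conjugate_exponents_def)
qed

lemma conjugate_exponents_sym: "conjugate_exponents p q \<Longrightarrow> conjugate_exponents q p"
  by (auto simp: conjugate_exponents_def)

lemma conjugate_exponents_mult:
  assumes "conjugate_exponents p q"
  shows "(p - 1) * q = p"
proof -
  have "1 < p" "1 < q" "1 / p + 1 / q = 1" using assms by (auto simp: conjugate_exponents_def)
  then show ?thesis by (simp add: field_simps)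
qed

text \<open>Hoelder's inequality, from Young's inequality for the coordinates of the normalised sequences.\<close>

lemma lp_Hoelder:
  assumes pq: "conjugate_exponents p q" and x: "x \<in> lp p" and y: "y \<in> lp q"
  shows lp_pairing_summable: "summable (\<lambda>j. cmod (x j * cnj (y j)))"
    and lp_pairing_bound: "cmod (lp_pairing x y) \<le> lp_norm p x * lp_norm q y"
proof -
  define A B where "A = lp_norm p x" and "B = lp_norm q y"
  have e: "1 < p" "1 < q" "1 / p + 1 / q = 1" using pq by (auto simp: conjugate_exponents_def)
  have "summable (\<lambda>j. cmod (x j * cnj (y j))) \<and> (\<Sum>j. cmod (x j * cnj (y j))) \<le> A * B"
  proof (cases "A = 0 \<or> B = 0")
    case True
    then show ?thesis using x y e by (auto simp: A_def B_def lp_norm_eq_0_iff)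
  next
    case False
    then have AB: "0 < A" "0 < B" using lp_norm_nonneg by (auto simp: A_def B_def less_le)
    define f where "f j = A * B * (cmod (x j) powr p / A powr p / p + cmod (y j) powr q / B powr q / q)" for j
    have *: "cmod (x j * cnj (y j)) \<le> f j" for j
    proof -
      have "cmod (x j) / A * (cmod (y j) / B) \<le> (cmod (x j) / A) powr p / p + (cmod (y j) / B) powr q / q"
        using AB e by (intro Youngs_inequality) auto
      then have "A * B * (cmod (x j) / A * (cmod (y j) / B)) \<le> f j"
        unfolding f_def using AB by (intro mult_left_mono) (auto simp: powr_divide)
      then show ?thesis using AB by (simp add: norm_mult)
    qed
    have sx: "(\<lambda>j. cmod (x j) powr p) sums (A powr p)" and sy: "(\<lambda>j. cmod (y j) powr q) sums (B powr q)"
      using x y e by (auto simp: A_def B_def lp_norm_powr lp_def summable_sums)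
    have "f sums (A * B * (A powr p / A powr p / p + B powr q / B powr q / q))"
      unfolding f_def by (intro sums_mult sums_add sums_divide sx sy)
    then have f: "f sums (A * B)" using AB e by simp
    have s: "summable (\<lambda>j. cmod (x j * cnj (y j)))"
      by (rule summable_comparison_test'[OF sums_summable[OF f], of 0]) (use * in auto)
    then show ?thesis using suminf_le[OF * s sums_summable[OF f]] f by (simp add: sums_iff)
  qed
  then show "summable (\<lambda>j. cmod (x j * cnj (y j)))" "cmod (lp_pairing x y) \<le> lp_norm p x * lp_norm q y"
    unfolding lp_pairing_def A_def B_def using summable_norm[of "\<lambda>j. x j * cnj (y j)"] by (auto intro: order_trans)
qed

lemma lp_pairing_sums:
  assumes "conjugate_exponents p q" "x \<in> lp p" "y \<in> lp q"
  shows "(\<lambda>j. x j * cnj (y j)) sums lp_pairing x y"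
  unfolding lp_pairing_def
  by (rule summable_sums[OF summable_norm_cancel[OF lp_pairing_summable[OF assms]]])

lemma lp_pairing_add_left:
  assumes "conjugate_exponents p q" "x \<in> lp p" "y \<in> lp p" "z \<in> lp q"
  shows "lp_pairing (\<lambda>j. x j + y j) z = lp_pairing x z + lp_pairing y z"
  using sums_unique[OF sums_add[OF lp_pairing_sums[OF assms(1,2,4)] lp_pairing_sums[OF assms(1,3,4)]]]
  by (simp add: lp_pairing_def distrib_right)

lemma lp_pairing_scale_left:
  assumes "conjugate_exponents p q" "x \<in> lp p" "z \<in> lp q"
  shows "lp_pairing (\<lambda>j. c * x j) z = c * lp_pairing x z"
  using sums_unique[OF sums_mult[OF lp_pairing_sums[OF assms], of c]]
  by (simp add: lp_pairing_def mult.assoc)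

lemma lp_pairing_commute:
  assumes "conjugate_exponents p q" "x \<in> lp p" "z \<in> lp q"
  shows "lp_pairing z x = cnj (lp_pairing x z)"
  using sums_unique[OF sums_cnj[THEN iffD2, OF lp_pairing_sums[OF assms]]]
  by (simp add: lp_pairing_def mult.commute)

lemma lp_pairing_diff_left:
  assumes "conjugate_exponents p q" "x \<in> lp p" "y \<in> lp p" "z \<in> lp q"
  shows "lp_pairing (\<lambda>j. x j - y j) z = lp_pairing x z - lp_pairing y z"
  using sums_unique[OF sums_diff[OF lp_pairing_sums[OF assms(1,2,4)] lp_pairing_sums[OF assms(1,3,4)]]]
  by (simp add: lp_pairing_def left_diff_distrib)

lemma lp_pairing_diff_right:
  assumes "conjugate_exponents p q" "x \<in> lp p" "y \<in> lp q" "z \<in> lp q"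
  shows "lp_pairing x (\<lambda>j. y j - z j) = lp_pairing x y - lp_pairing x z"
  using sums_unique[OF sums_diff[OF lp_pairing_sums[OF assms(1,2,3)] lp_pairing_sums[OF assms(1,2,4)]]]
  by (simp add: lp_pairing_def right_diff_distrib)

section \<open>The duality map\<close>

lemma cmod_lp_duality_map: "cmod (lp_duality_map p x j) = cmod (x j) powr (p - 1)"
proof (cases "x j = 0")
  case False
  have "cmod (x j) powr (p - 1) = cmod (x j) powr (1 + (p - 2))" by simp
  also have "\<dots> = cmod (x j) * cmod (x j) powr (p - 2)"
    unfolding powr_add using False by simp
  finally show ?thesis by (simp add: lp_duality_map_def norm_mult)
qed (simp add: lp_duality_map_def)

lemma cmod_lp_duality_map_powr:
  assumes "conjugate_exponents p q"
  shows "cmod (lp_duality_map p x j) powr q = cmod (x j) powr p"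
  by (simp add: cmod_lp_duality_map powr_powr conjugate_exponents_mult[OF assms])

lemma lp_duality_map_in_lp:
  assumes "conjugate_exponents p q" "x \<in> lp p"
  shows "lp_duality_map p x \<in> lp q"
  using assms by (simp add: lp_def cmod_lp_duality_map_powr)

lemma lp_norm_duality_map:
  assumes "conjugate_exponents p q"
  shows "lp_norm q (lp_duality_map p x) = (\<Sum>j. cmod (x j) powr p) powr (1 / q)"
  by (simp add: lp_norm_def cmod_lp_duality_map_powr[OF assms])

lemma mult_cnj_lp_duality_map:
  "x j * cnj (lp_duality_map p x j) = of_real (cmod (x j) powr p)"
proof (cases "x j = 0")
  case False
  have "x j * cnj (lp_duality_map p x j) = (x j * cnj (x j)) * of_real (cmod (x j) powr (p - 2))"
    by (simp add: lp_duality_map_def)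
  also have "\<dots> = of_real (cmod (x j) powr 2 * cmod (x j) powr (p - 2))"
    using False by (simp add: complex_norm_square[symmetric])
  also have "cmod (x j) powr 2 * cmod (x j) powr (p - 2) = cmod (x j) powr p"
    using powr_add[of "cmod (x j)" 2 "p - 2"] by simp
  finally show ?thesis .
qed (simp add: lp_duality_map_def)

lemma lp_pairing_duality_map:
  assumes "x \<in> lp p"
  shows "lp_pairing x (lp_duality_map p x) = of_real (\<Sum>j. cmod (x j) powr p)"
proof -
  have "summable (\<lambda>j. cmod (x j) powr p)" using assms by (simp add: lp_def)
  then show ?thesis unfolding lp_pairing_def mult_cnj_lp_duality_map by (rule suminf_of_real[symmetric])
qed

lemma lp_duality_map_unit:
  assumes pq: "conjugate_exponents p q" and x: "x \<in> lp p" "lp_norm p x = 1"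
  shows "lp_norm q (lp_duality_map p x) = 1"
    and "lp_pairing x (lp_duality_map p x) = 1"
proof -
  have "0 < p" using pq by (simp add: conjugate_exponents_def)
  from lp_norm_powr[OF this x(1)] x(2) have 1: "(\<Sum>j. cmod (x j) powr p) = 1" by simp
  show "lp_norm q (lp_duality_map p x) = 1"
    using pq by (simp add: lp_norm_duality_map 1)
  show "lp_pairing x (lp_duality_map p x) = 1"
    unfolding lp_pairing_duality_map[OF x(1)] 1 by simp
qed

section \<open>Truncation and perturbation\<close>

definition head :: "nat \<Rightarrow> (nat \<Rightarrow> complex) \<Rightarrow> (nat \<Rightarrow> complex)" where
  "head N x = (\<lambda>j. if j < N then x j else 0)"

lemma head_in_lp [simp]: "head N x \<in> lp p"
  unfolding lp_def mem_Collect_eq head_def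
  by (rule summable_finite[of "{..<N}"]) auto

lemma head_powr_sum: "(\<Sum>j. cmod (head N x j) powr p) = (\<Sum>j<N. cmod (x j) powr p)"
  by (subst suminf_finite[of "{..<N}"]) (auto simp: head_def)

lemma lp_tail_tendsto_0:
  assumes p: "0 < p" and x: "x \<in> lp p"
  shows "(\<lambda>N. lp_norm p (\<lambda>j. x j - head N x j)) \<longlonglongrightarrow> 0"
proof -
  define f where "f = (\<lambda>j. cmod (x j) powr p)"
  have f: "f sums suminf f" using x by (simp add: lp_def f_def summable_sums)
  have "(\<lambda>j. cmod (x j - head N x j) powr p) sums (suminf f - (\<Sum>j<N. f j))" for N
  proof -
    have "(\<lambda>j. if j \<in> {..<N} then f j else 0) sums (\<Sum>j<N. f j)"
      by (rule sums_If_finite_set) simp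
    from sums_diff[OF f this] show ?thesis
      by (rule sums_cong[THEN iffD1, rotated]) (auto simp: f_def head_def)
  qed
  then have *: "lp_norm p (\<lambda>j. x j - head N x j) = (suminf f - (\<Sum>j<N. f j)) powr (1 / p)" for N
    by (simp add: lp_norm_def sums_iff)
  have "(\<lambda>N. suminf f - (\<Sum>j<N. f j)) \<longlonglongrightarrow> suminf f - suminf f"
    using f by (intro tendsto_intros) (simp add: sums_def)
  then have "(\<lambda>N. (suminf f - (\<Sum>j<N. f j)) powr (1 / p)) \<longlonglongrightarrow> 0"
    using p sum_le_suminf[OF sums_summable[OF f]]
    by (intro tendsto_zero_powrI[where b = "1 / p"]) (auto simp: f_def)
  then show ?thesis by (simp add: *)
qed

lemma lp_norm_head_tendsto_0:
  assumes p: "0 < p" and u: "\<And>j. (\<lambda>k. u k j) \<longlonglongrightarrow> 0"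
  shows "(\<lambda>k. lp_norm p (head N (u k))) \<longlonglongrightarrow> 0"
proof -
  have "(\<lambda>k. \<Sum>j<N. cmod (u k j) powr p) \<longlonglongrightarrow> (\<Sum>j<N. 0)"
    using p u by (intro tendsto_sum tendsto_zero_powrI[where b = p] tendsto_norm_zero) auto
  then have "(\<lambda>k. (\<Sum>j<N. cmod (u k j) powr p) powr (1 / p)) \<longlonglongrightarrow> 0"
    using p by (intro tendsto_zero_powrI[where b = "1 / p"]) (auto simp: sum_nonneg)
  then show ?thesis by (simp add: lp_norm_def head_powr_sum)
qed

text \<open>The limit of a sequence of pairings survives norm-null changes of both arguments, as long as the
  original sequences are bounded: this moves \<open>\<langle>T u\<^sub>k, J u\<^sub>k\<rangle> \<rightarrow> \<mu>\<close> to finitely supported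
  replacements of \<open>u\<^sub>k\<close> and \<open>J u\<^sub>k\<close>.\<close>

lemma lp_pairing_tendsto_perturbed:
  assumes pq: "conjugate_exponents p q"
    and a: "\<And>k. a k \<in> lp p" "\<And>k. a' k \<in> lp p" and b: "\<And>k. b k \<in> lp q" "\<And>k. b' k \<in> lp q"
    and A: "\<And>k. lp_norm p (a k) \<le> A" and B: "\<And>k. lp_norm q (b k) \<le> B"
    and a0: "(\<lambda>k. lp_norm p (\<lambda>j. a' k j - a k j)) \<longlonglongrightarrow> 0"
    and b0: "(\<lambda>k. lp_norm q (\<lambda>j. b' k j - b k j)) \<longlonglongrightarrow> 0"
    and lim: "(\<lambda>k. lp_pairing (a k) (b k)) \<longlonglongrightarrow> l"
  shows "(\<lambda>k. lp_pairing (a' k) (b' k)) \<longlonglongrightarrow> l"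
proof -
  define \<alpha> \<beta> where "\<alpha> k = lp_norm p (\<lambda>j. a' k j - a k j)" and "\<beta> k = lp_norm q (\<lambda>j. b' k j - b k j)" for k
  have e: "1 \<le> p" "1 \<le> q" using pq by (auto simp: conjugate_exponents_def)
  have "cmod (lp_pairing (a' k) (b' k) - lp_pairing (a k) (b k)) \<le> \<alpha> k * (\<beta> k + B) + A * \<beta> k" for k
  proof -
    have "lp_norm q (b' k) \<le> \<beta> k + B"
      using abs_lp_norm_diff_le[OF e(2) b(2)[of k] b(1)[of k]] B[of k] by (simp add: \<beta>_def)
    then have 1: "cmod (lp_pairing (\<lambda>j. a' k j - a k j) (b' k)) \<le> \<alpha> k * (\<beta> k + B)"
      using order_trans[OF lp_pairing_bound[OF pq lp_diff[OF e(1) a(2)[of k] a(1)[of k]] b(2)[of k]]]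
      by (simp add: \<alpha>_def mult_left_mono)
    have 2: "cmod (lp_pairing (a k) (\<lambda>j. b' k j - b k j)) \<le> A * \<beta> k"
      using order_trans[OF lp_pairing_bound[OF pq a(1)[of k] lp_diff[OF e(2) b(2)[of k] b(1)[of k]]]] A[of k]
      by (simp add: \<beta>_def mult_right_mono)
    have 3: "lp_pairing (a' k) (b' k) - lp_pairing (a k) (b k) =
        lp_pairing (\<lambda>j. a' k j - a k j) (b' k) + lp_pairing (a k) (\<lambda>j. b' k j - b k j)"
      using lp_pairing_diff_left[OF pq a(2)[of k] a(1)[of k] b(2)[of k]]
        lp_pairing_diff_right[OF pq a(1)[of k] b(2)[of k] b(1)[of k]] by simp
    show ?thesis
      unfolding 3 by (rule order_trans[OF norm_triangle_ineq add_mono[OF 1 2]])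
  qed
  moreover have "(\<lambda>k. \<alpha> k * (\<beta> k + B) + A * \<beta> k) \<longlonglongrightarrow> 0 * (0 + B) + A * 0"
    using a0 b0 by (intro tendsto_intros) (simp_all add: \<alpha>_def \<beta>_def)
  then have "(\<lambda>k. \<alpha> k * (\<beta> k + B) + A * \<beta> k) \<longlonglongrightarrow> 0" by simp
  ultimately have "(\<lambda>k. lp_pairing (a' k) (b' k) - lp_pairing (a k) (b k)) \<longlonglongrightarrow> 0"
    by (rule Lim_null_comparison[OF always_eventually[OF allI]])
  from tendsto_add[OF this lim] show ?thesis by simp
qed

text \<open>The duality map \<open>J\<close> is not linear, so weak convergence of a sequence says nothing directly about
  its image under \<open>J\<close>. It does give coordinatewise convergence of the image to zero, and for
  bounded sequences this suffices: the tail of \<open>y\<close> is small in norm, and only finitely many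
  coordinates remain.\<close>

lemma lp_pairing_coordinatewise_null:
  assumes pq: "conjugate_exponents p q"
    and u: "\<And>k. u k \<in> lp p" "\<And>k. lp_norm p (u k) \<le> B" "\<And>j. (\<lambda>k. u k j) \<longlonglongrightarrow> 0"
    and y: "y \<in> lp q"
  shows "(\<lambda>k. lp_pairing (u k) y) \<longlonglongrightarrow> 0"
proof (rule LIMSEQ_I)
  fix e :: real assume e: "0 < e"
  have q: "1 \<le> q" "0 < q" using pq by (auto simp: conjugate_exponents_def)
  have B: "0 \<le> B" using u(2)[of 0] lp_norm_nonneg[of p "u 0"] by linarith
  have "(\<lambda>N. B * lp_norm q (\<lambda>j. y j - head N y j)) \<longlonglongrightarrow> B * 0"
    by (intro tendsto_mult tendsto_const lp_tail_tendsto_0 q y)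
  then obtain N where N: "B * lp_norm q (\<lambda>j. y j - head N y j) < e / 2"
    using order_tendstoD(2)[of _ _ _ "e / 2"] e by (fastforce simp: eventually_sequentially)
  have h: "lp_pairing (u k) (head N y) = (\<Sum>j<N. u k j * cnj (y j))" for k
    unfolding lp_pairing_def by (subst suminf_finite[of "{..<N}"]) (auto simp: head_def)
  have "(\<lambda>k. lp_pairing (u k) (head N y)) \<longlonglongrightarrow> (\<Sum>j<N. 0 * cnj (y j))"
    unfolding h by (intro tendsto_intros u)
  then obtain K where K: "\<And>k. k \<ge> K \<Longrightarrow> cmod (lp_pairing (u k) (head N y)) < e / 2"
    using e LIMSEQ_D[of _ 0 "e / 2"] by auto
  have "cmod (lp_pairing (u k) y - 0) < e" if "k \<ge> K" for k
  proof -
    have "cmod (lp_pairing (u k) (\<lambda>j. y j - head N y j)) \<le> lp_norm p (u k) * lp_norm q (\<lambda>j. y j - head N y j)"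
      by (intro lp_pairing_bound[OF pq] u lp_diff q y) simp
    also have "\<dots> < e / 2" using N mult_right_mono[OF u(2)[of k] lp_norm_nonneg[of q "\<lambda>j. y j - head N y j"]] by linarith
    finally have "cmod (lp_pairing (u k) y - lp_pairing (u k) (head N y)) < e / 2"
      using lp_pairing_diff_right[OF pq u(1)[of k] y head_in_lp] by simp
    then show ?thesis using K[OF that]
      norm_triangle_sub[of "lp_pairing (u k) y" "lp_pairing (u k) (head N y)"] by simp
  qed
  then show "\<exists>K. \<forall>k\<ge>K. cmod (lp_pairing (u k) y - 0) < e" by blast
qed

section \<open>Bounded linear functionals\<close>

definition lp_functional :: "real \<Rightarrow> ((nat \<Rightarrow> complex) \<Rightarrow> complex) \<Rightarrow> bool" where
  "lp_functional p g \<longleftrightarrow>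
     (\<forall>x\<in>lp p. \<forall>y\<in>lp p. g (\<lambda>j. x j + y j) = g x + g y) \<and>
     (\<forall>c. \<forall>x\<in>lp p. g (\<lambda>j. c * x j) = c * g x) \<and>
     (\<exists>C. \<forall>x\<in>lp p. cmod (g x) \<le> C * lp_norm p x)"

lemma
  assumes "lp_functional p g" "x \<in> lp p"
  shows lp_functional_add: "y \<in> lp p \<Longrightarrow> g (\<lambda>j. x j + y j) = g x + g y"
    and lp_functional_scale: "g (\<lambda>j. c * x j) = c * g x"
  using assms by (simp_all add: lp_functional_def)

lemma lp_functional_diff:
  assumes "lp_functional p g" "0 < p" "x \<in> lp p" "y \<in> lp p"
  shows "g (\<lambda>j. x j - y j) = g x - g y"
proof -
  have "g (\<lambda>j. x j + - 1 * y j) = g x + g (\<lambda>j. - 1 * y j)"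
    by (rule lp_functional_add[OF assms(1,3) lp_scale[OF assms(2,4)]])
  also have "g (\<lambda>j. - 1 * y j) = - 1 * g y" by (rule lp_functional_scale[OF assms(1,4)])
  finally show ?thesis by simp
qed

lemma lp_functional_tendsto:
  assumes g: "lp_functional p g" and p: "1 \<le> p" and u: "\<And>k. u k \<in> lp p" "\<And>k. v k \<in> lp p"
    and uv: "(\<lambda>k. lp_norm p (\<lambda>j. v k j - u k j)) \<longlonglongrightarrow> 0" and lim: "(\<lambda>k. g (u k)) \<longlonglongrightarrow> l"
  shows "(\<lambda>k. g (v k)) \<longlonglongrightarrow> l"
proof -
  obtain C where C: "\<And>x. x \<in> lp p \<Longrightarrow> cmod (g x) \<le> C * lp_norm p x"
    using g unfolding lp_functional_def by blast
  have "cmod (g (\<lambda>j. v k j - u k j)) \<le> C * lp_norm p (\<lambda>j. v k j - u k j)" for k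
    by (intro C lp_diff p u)
  moreover have "(\<lambda>k. C * lp_norm p (\<lambda>j. v k j - u k j)) \<longlonglongrightarrow> C * 0" by (intro tendsto_intros uv)
  then have "(\<lambda>k. C * lp_norm p (\<lambda>j. v k j - u k j)) \<longlonglongrightarrow> 0" by simp
  ultimately have "(\<lambda>k. g (\<lambda>j. v k j - u k j)) \<longlonglongrightarrow> 0"
    by (rule Lim_null_comparison[OF always_eventually[OF allI]])
  then have "(\<lambda>k. g (v k) - g (u k)) \<longlonglongrightarrow> 0"
    using lp_functional_diff[OF g] u p by simp
  from tendsto_add[OF this lim] show ?thesis by simp
qed

text \<open>The Riesz representation. It is needed because weak convergence is tested with elements of
  \<open>\<ell>\<^sub>q\<close> only, whereas the construction meets the functionals \<open>x \<mapsto> \<langle>T x, v\<rangle>\<close>; representing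
  them replaces the adjoint of \<open>T\<close>. The representing sequence has \<open>q\<close>-norm at most a bound
  for \<open>g\<close>, as one sees by applying \<open>g\<close> to the images of its truncations under the duality map.\<close>

lemma lp_functional_representation:
  assumes pq: "conjugate_exponents p q" and g: "lp_functional p g"
  obtains y where "y \<in> lp q" "\<And>x. x \<in> lp p \<Longrightarrow> g x = lp_pairing x y"
proof -
  have e: "1 < p" "1 < q" "1 / p + 1 / q = 1" using pq by (auto simp: conjugate_exponents_def)
  define a where "a i = g (\<lambda>j. if j = i then 1 else 0)" for i
  define y where "y i = cnj (a i)" for i
  obtain C' where C': "\<And>x. x \<in> lp p \<Longrightarrow> cmod (g x) \<le> C' * lp_norm p x"
    using g unfolding lp_functional_def by blast
  define C where "C = max C' 0"
  have C: "cmod (g x) \<le> C * lp_norm p x" if "x \<in> lp p" for x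
    using C'[OF that] mult_right_mono[of C' C "lp_norm p x"] by (simp add: C_def)
  have g_head: "g (head N x) = (\<Sum>i<N. x i * a i)" for N x
  proof (induction N)
    case 0
    show ?case using lp_functional_scale[OF g lp_zero, of 0] by (simp add: head_def)
  next
    case (Suc N)
    have unit: "(\<lambda>j. if j = N then 1 else 0) \<in> lp p"
      unfolding lp_def mem_Collect_eq by (rule summable_finite[of "{N}"]) auto
    have "head (Suc N) x = (\<lambda>j. head N x j + x N * (if j = N then 1 else 0))"
      by (auto simp: head_def fun_eq_iff less_Suc_eq)
    moreover have "g (\<lambda>j. head N x j + x N * (if j = N then 1 else 0)) = g (head N x) + x N * a N"
      using lp_functional_add[OF g head_in_lp lp_scale[OF _ unit]] lp_functional_scale[OF g unit] e by (simp add: a_def)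
    ultimately show ?case using Suc by simp
  qed
  have bound: "(\<Sum>i<N. cmod (y i) powr q) \<le> C powr q" for N
  proof -
    define S where "S = (\<Sum>i<N. cmod (y i) powr q)"
    define x where "x = lp_duality_map q (head N y)"
    have x: "x \<in> lp p" "lp_norm p x = S powr (1 / p)"
      using conjugate_exponents_sym[OF pq]
      by (simp_all add: x_def S_def lp_duality_map_in_lp lp_norm_duality_map head_powr_sum)
    have "x i * a i = of_real (cmod (y i) powr q)" if "i < N" for i
    proof -
      have "cnj (head N y i * cnj (x i)) = of_real (cmod (y i) powr q)"
        unfolding x_def mult_cnj_lp_duality_map using that by (simp add: head_def)
      then show ?thesis using that by (simp add: head_def y_def mult.commute)
    qed
    then have "(\<Sum>i<N. x i * a i) = of_real S" by (simp add: S_def)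
    moreover have "head N x = x" by (auto simp: x_def head_def lp_duality_map_def)
    ultimately have "g x = of_real S" using g_head[of N x] by simp
    moreover have S: "0 \<le> S" by (simp add: S_def sum_nonneg)
    ultimately have le: "S \<le> C * S powr (1 / p)" using C[OF x(1)] x(2) by simp
    show ?thesis
    proof (cases "S = 0")
      case True
      then show ?thesis by (simp add: S_def)
    next
      case False
      have "S = S powr (1 / q + 1 / p)" using False S e(3) by (simp add: add.commute)
      also have "\<dots> = S powr (1 / q) * S powr (1 / p)" by (rule powr_add)
      finally have "S powr (1 / q) * S powr (1 / p) \<le> C * S powr (1 / p)" using le by simp
      then have "S powr (1 / q) \<le> C" using False S by simp
      then have "(S powr (1 / q)) powr q \<le> C powr q" using e by (intro powr_mono2) auto
      then show ?thesis using S e by (simp add: powr_powr S_def)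
    qed
  qed
  have y: "y \<in> lp q"
    unfolding lp_def using bound by (auto intro!: summableI_nonneg_bounded)
  have "g x = lp_pairing x y" if x: "x \<in> lp p" for x
  proof -
    have "(\<lambda>N. lp_norm p (\<lambda>j. head N x j - x j)) \<longlonglongrightarrow> 0"
      using lp_tail_tendsto_0[OF _ x] e lp_norm_minus_commute[of p x] by simp
    from lp_functional_tendsto[where u = "\<lambda>_. x", OF g less_imp_le[OF e(1)] x head_in_lp this tendsto_const]
    have "(\<lambda>N. g (head N x)) \<longlonglongrightarrow> g x" .
    moreover have "(\<lambda>N. g (head N x)) \<longlonglongrightarrow> lp_pairing x y"
      using lp_pairing_sums[OF pq x y] by (simp add: g_head sums_def y_def)
    ultimately show ?thesis by (rule LIMSEQ_unique)
  qed
  with y show ?thesis by (rule that)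
qed

lemma lp_pairing_scale_right: 
  assumes "conjugate_exponents p q" "x \<in> lp p" "y \<in> lp q"
  shows "lp_pairing x (\<lambda>j. c * y j) = cnj c * lp_pairing x y"
  using sums_unique[OF sums_mult[OF lp_pairing_sums[OF assms], of "cnj c"]]
  by (simp add: lp_pairing_def mult_ac)

lemma lp_functional_pairing:
  assumes pq: "conjugate_exponents p q" and y: "y \<in> lp q"
  shows "lp_functional p (\<lambda>x. lp_pairing x y)"
  unfolding lp_functional_def
  using lp_pairing_add_left[OF pq _ _ y] lp_pairing_scale_left[OF pq _ y] lp_pairing_bound[OF pq _ y]
  by (auto intro!: exI[of _ "lp_norm q y"] simp: mult.commute)

section \<open>Finitely supported perturbations in the kernels of functionals\<close>

definition finite_support_from :: "nat \<Rightarrow> (nat \<Rightarrow> complex) set" where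
  "finite_support_from N = {x. \<exists>M. \<forall>j. x j \<noteq> 0 \<longrightarrow> N \<le> j \<and> j < M}"

lemma finite_support_from_in_lp:
  assumes "x \<in> finite_support_from N"
  shows "x \<in> lp p"
proof -
  obtain M where "\<And>j. x j \<noteq> 0 \<Longrightarrow> j < M" using assms by (auto simp: finite_support_from_def)
  then show ?thesis unfolding lp_def mem_Collect_eq
    by (intro summable_finite[of "{..<M}"]) auto
qed

lemma finite_support_from_scale:
  "x \<in> finite_support_from N \<Longrightarrow> (\<lambda>j. c * x j) \<in> finite_support_from N"
  by (auto simp: finite_support_from_def)

lemma finite_support_from_diff:
  assumes "x \<in> finite_support_from N" "y \<in> finite_support_from N"
  shows "(\<lambda>j. x j - y j) \<in> finite_support_from N"
proof -
  obtain M M' where "\<And>j. x j \<noteq> 0 \<Longrightarrow> N \<le> j \<and> j < M" "\<And>j. y j \<noteq> 0 \<Longrightarrow> N \<le> j \<and> j < M'"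
    using assms unfolding finite_support_from_def by blast
  then have "x j - y j \<noteq> 0 \<Longrightarrow> N \<le> j \<and> j < max M M'" for j
    by (cases "x j = 0"; cases "y j = 0") fastforce+
  then show ?thesis unfolding finite_support_from_def by blast
qed

text \<open>A gliding hump that meets finitely many linear conditions exactly. Cutting off the first \<open>N\<close>
  coordinates and a small tail changes \<open>u\<^sub>k\<close> by a null sequence. The functionals are then
  treated one at a time within the space of finitely supported sequences that the earlier ones
  annihilate: if \<open>g\<close> does not vanish on this space, choose \<open>e\<close> in it with \<open>g e \<noteq> 0\<close> and subtract
  \<open>(g u\<^sub>k / g e) e\<close>, which tends to zero with \<open>g u\<^sub>k\<close>. As \<open>e\<close> is in the same space, finite
  support and the earlier conditions persist.\<close>

lemma finitely_supported_perturbation_in_kernels: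
  assumes r: "1 \<le> r" and u: "\<And>k. u k \<in> lp r" and null: "\<And>j. (\<lambda>k. u k j) \<longlonglongrightarrow> 0"
    and "finite G" and "\<And>g. g \<in> G \<Longrightarrow> lp_functional r g" and "\<And>g. g \<in> G \<Longrightarrow> (\<lambda>k. g (u k)) \<longlonglongrightarrow> 0"
  shows "\<exists>u'. (\<forall>k. u' k \<in> finite_support_from N \<and> (\<forall>g\<in>G. g (u' k) = 0)) \<and>
              (\<lambda>k. lp_norm r (\<lambda>j. u' k j - u k j)) \<longlonglongrightarrow> 0"
  using assms(4-6)
proof (induction G)
  case empty
  have r0: "0 < r" using r by simp
  have "\<exists>M. lp_norm r (\<lambda>j. u k j - head M (u k) j) < inverse (real (Suc k))" for k
    using order_tendstoD(2)[OF lp_tail_tendsto_0[OF r0 u[of k]], of "inverse (real (Suc k))"]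
    by (auto simp: eventually_sequentially)
  then obtain M where M: "\<And>k. lp_norm r (\<lambda>j. u k j - head (M k) (u k) j) < inverse (real (Suc k))"
    by metis
  \<comment> \<open>The minimum makes the support empty, not \<open>{M k..<N}\<close>, if \<open>M k < N\<close>.\<close>
  define u' where "u' k = (\<lambda>j. head (M k) (u k) j - head (min N (M k)) (u k) j)" for k
  have "u' k \<in> finite_support_from N" for k
    unfolding finite_support_from_def mem_Collect_eq
    by (rule exI[of _ "M k"]) (auto simp: u'_def head_def)
  moreover have "(\<lambda>k. lp_norm r (\<lambda>j. u' k j - u k j)) \<longlonglongrightarrow> 0"
  proof (rule Lim_null_comparison[OF always_eventually[OF allI]])
    fix k
    have "(\<lambda>j. u k j - u' k j) = (\<lambda>j. (u k j - head (M k) (u k) j) + head (M k) (head N (u k)) j)"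
      by (auto simp: u'_def head_def)
    then have "lp_norm r (\<lambda>j. u' k j - u k j) \<le>
        lp_norm r (\<lambda>j. u k j - head (M k) (u k) j) + lp_norm r (head (M k) (head N (u k)))"
      using lp_norm_triangle[OF r lp_diff[OF r u[of k] head_in_lp] head_in_lp, of "M k" "u k" "M k" "head N (u k)"]
        lp_norm_minus_commute[of r "u' k" "u k"] by simp
    moreover have "lp_norm r (head (M k) (head N (u k))) \<le> lp_norm r (head N (u k))"
    proof -
      have "(\<Sum>j. cmod (head (M k) (head N (u k)) j) powr r) \<le> (\<Sum>j. cmod (head N (u k) j) powr r)"
        by (rule suminf_le) (use head_in_lp[of _ _ r] in \<open>auto simp: lp_def head_def\<close>)
      moreover have "0 \<le> (\<Sum>j. cmod (head (M k) (head N (u k)) j) powr r)"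
        by (simp add: head_powr_sum sum_nonneg)
      ultimately show ?thesis unfolding lp_norm_def using r by (intro powr_mono2) auto
    qed
    ultimately show "norm (lp_norm r (\<lambda>j. u' k j - u k j)) \<le> inverse (real (Suc k)) + lp_norm r (head N (u k))"
      using M[of k] by simp
  next
    show "(\<lambda>k. inverse (real (Suc k)) + lp_norm r (head N (u k))) \<longlonglongrightarrow> 0"
      using tendsto_add[OF LIMSEQ_inverse_real_of_nat lp_norm_head_tendsto_0[OF r0 null]] by simp
  qed
  ultimately show ?case by blast
next
  case (insert g G)
  have r0: "0 < r" using r by simp
  have "\<exists>u'. (\<forall>k. u' k \<in> finite_support_from N \<and> (\<forall>g\<in>G. g (u' k) = 0)) \<and>
              (\<lambda>k. lp_norm r (\<lambda>j. u' k j - u k j)) \<longlonglongrightarrow> 0"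
    by (rule insert.IH) (simp_all add: insert.prems)
  then obtain u' where u': "\<And>k. u' k \<in> finite_support_from N" "\<And>k h. h \<in> G \<Longrightarrow> h (u' k) = 0"
    and lim: "(\<lambda>k. lp_norm r (\<lambda>j. u' k j - u k j)) \<longlonglongrightarrow> 0" by blast
  have lp: "u' k \<in> lp r" for k using u'(1) by (rule finite_support_from_in_lp)
  have g: "lp_functional r g" using insert.prems by simp
  show ?case
  proof (cases "\<exists>e\<in>finite_support_from N. (\<forall>h\<in>G. h e = 0) \<and> g e \<noteq> 0")
    case False
    then have "\<forall>k. u' k \<in> finite_support_from N \<and> (\<forall>h\<in>insert g G. h (u' k) = 0)" using u' by blast
    then show ?thesis using lim by blast
  next
    case True
    then obtain e where e: "e \<in> finite_support_from N" "\<And>h. h \<in> G \<Longrightarrow> h e = 0" "g e \<noteq> 0" by blast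
    define c where "c k = g (u' k) / g e" for k
    define u'' where "u'' k = (\<lambda>j. u' k j - c k * e j)" for k
    have e_lp: "e \<in> lp r" and ce_lp: "(\<lambda>j. c k * e j) \<in> lp r" for k
      using e(1) finite_support_from_scale[OF e(1)] by (auto intro: finite_support_from_in_lp)
    have "(\<lambda>k. g (u' k)) \<longlonglongrightarrow> 0"
      by (rule lp_functional_tendsto[OF g r u lp lim]) (simp add: insert.prems)
    then have c: "c \<longlonglongrightarrow> 0" unfolding c_def using e(3) by (intro tendsto_divide_zero)
    have "h (u'' k) = 0" if "h \<in> insert g G" for h k
    proof -
      have "h (u'' k) = h (u' k) - c k * h e"
        using lp_functional_diff[OF _ r0 lp ce_lp] lp_functional_scale[OF _ e_lp] insert.prems(1)[OF that]
        by (simp add: u''_def)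
      moreover have "h = g \<or> h (u' k) = 0 \<and> h e = 0" using that u'(2) e(2) by blast
      ultimately show ?thesis using e(3) by (auto simp: c_def)
    qed
    moreover have "u'' k \<in> finite_support_from N" for k
      unfolding u''_def by (intro finite_support_from_diff finite_support_from_scale u' e)
    moreover have "(\<lambda>k. lp_norm r (\<lambda>j. u'' k j - u k j)) \<longlonglongrightarrow> 0"
    proof (rule Lim_null_comparison[OF always_eventually[OF allI]])
      fix k
      have "(\<lambda>j. u'' k j - u k j) = (\<lambda>j. (u' k j - u k j) - c k * e j)"
        by (auto simp: u''_def)
      then show "norm (lp_norm r (\<lambda>j. u'' k j - u k j)) \<le> lp_norm r (\<lambda>j. u' k j - u k j) + cmod (c k) * lp_norm r e"
        using lp_norm_diff_triangle[OF r lp_diff[OF r lp u] ce_lp, of k k k] lp_norm_scale[OF r0 e_lp, of "c k"] by simp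
    next
      show "(\<lambda>k. lp_norm r (\<lambda>j. u' k j - u k j) + cmod (c k) * lp_norm r e) \<longlonglongrightarrow> 0"
        using tendsto_add[OF lim tendsto_mult_left_zero[OF tendsto_norm_zero[OF c]]] by simp
    qed
    ultimately show ?thesis by blast
  qed
qed

lemma lp_norm_tendsto_perturbed:
  assumes r: "1 \<le> r" and u: "\<And>k. u k \<in> lp r" "\<And>k. u' k \<in> lp r" and 1: "\<And>k. lp_norm r (u k) = 1"
    and lim: "(\<lambda>k. lp_norm r (\<lambda>j. u' k j - u k j)) \<longlonglongrightarrow> 0"
  shows "(\<lambda>k. lp_norm r (u' k)) \<longlonglongrightarrow> 1"
proof -
  have "(\<lambda>k. lp_norm r (u' k) - lp_norm r (u k)) \<longlonglongrightarrow> 0"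
    by (rule Lim_null_comparison[OF always_eventually[OF allI] lim])
      (use abs_lp_norm_diff_le[OF r] u in auto)
  from tendsto_add[OF this tendsto_const[of 1]] show ?thesis by (simp add: 1)
qed

section \<open>Bounded operators and weakly null sequences\<close>

lemma
  assumes "lp_bounded_operator p T" "x \<in> lp p"
  shows lp_bounded_operator_in_lp: "T x \<in> lp p"
    and lp_bounded_operator_add: "y \<in> lp p \<Longrightarrow> T (\<lambda>j. x j + y j) = (\<lambda>j. T x j + T y j)"
    and lp_bounded_operator_scale: "T (\<lambda>j. c * x j) = (\<lambda>j. c * T x j)"
  using assms by (simp_all add: lp_bounded_operator_def)

lemma lp_bounded_operator_bound:
  assumes "lp_bounded_operator p T"
  obtains C where "0 \<le> C" "\<And>x. x \<in> lp p \<Longrightarrow> lp_norm p (T x) \<le> C * lp_norm p x"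
proof -
  obtain C where C: "\<And>x. x \<in> lp p \<Longrightarrow> lp_norm p (T x) \<le> C * lp_norm p x"
    using assms unfolding lp_bounded_operator_def by blast
  have "lp_norm p (T x) \<le> max C 0 * lp_norm p x" if "x \<in> lp p" for x
    using C[OF that] mult_right_mono[of C "max C 0" "lp_norm p x"] by simp
  then show ?thesis using that[of "max C 0"] by simp
qed

lemma lp_bounded_operator_diff:
  assumes T: "lp_bounded_operator p T" and p: "0 < p" and x: "x \<in> lp p" and y: "y \<in> lp p"
  shows "T (\<lambda>j. x j - y j) = (\<lambda>j. T x j - T y j)"
proof -
  have "T (\<lambda>j. x j + - 1 * y j) = (\<lambda>j. T x j + T (\<lambda>j. - 1 * y j) j)"
    by (rule lp_bounded_operator_add[OF T x lp_scale[OF p y]])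
  moreover have "T (\<lambda>j. - 1 * y j) = (\<lambda>j. - 1 * T y j)"
    by (rule lp_bounded_operator_scale[OF T y])
  ultimately show ?thesis by simp
qed

lemma lp_functional_pairing_operator:
  assumes pq: "conjugate_exponents p q" and T: "lp_bounded_operator p T" and y: "y \<in> lp q"
  shows "lp_functional p (\<lambda>x. lp_pairing (T x) y)"
proof -
  obtain C where C: "0 \<le> C" "\<And>x. x \<in> lp p \<Longrightarrow> lp_norm p (T x) \<le> C * lp_norm p x"
    using lp_bounded_operator_bound[OF T] by blast
  have "cmod (lp_pairing (T x) y) \<le> C * lp_norm q y * lp_norm p x" if x: "x \<in> lp p" for x
  proof -
    have "cmod (lp_pairing (T x) y) \<le> lp_norm p (T x) * lp_norm q y"
      by (rule lp_pairing_bound[OF pq lp_bounded_operator_in_lp[OF T x] y])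
    also have "\<dots> \<le> C * lp_norm p x * lp_norm q y"
      using C(2)[OF x] by (simp add: mult_right_mono)
    finally show ?thesis by (simp add: mult_ac)
  qed
  then show ?thesis
    unfolding lp_functional_def
    by (auto simp: lp_bounded_operator_add[OF T] lp_bounded_operator_scale[OF T]
          lp_pairing_add_left[OF pq] lp_pairing_scale_left[OF pq] lp_bounded_operator_in_lp[OF T] y)
qed

lemma weakly_null_functional:
  assumes pq: "conjugate_exponents p q" and u: "\<And>k. u k \<in> lp p" "lp_weakly_null q u"
    and g: "lp_functional p g"
  shows "(\<lambda>k. g (u k)) \<longlonglongrightarrow> 0"
proof -
  obtain y where "y \<in> lp q" "\<And>x. x \<in> lp p \<Longrightarrow> g x = lp_pairing x y"
    using lp_functional_representation[OF pq g] by blast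
  then show ?thesis using u by (simp add: lp_weakly_null_def)
qed

lemma weakly_null_coordinate:
  assumes "lp_weakly_null q u"
  shows "(\<lambda>k. u k j) \<longlonglongrightarrow> 0"
proof -
  define e where "e = (\<lambda>i. if i = j then 1 else (0::complex))"
  have "e \<in> lp q"
    unfolding lp_def mem_Collect_eq by (rule summable_finite[of "{j}"]) (auto simp: e_def)
  moreover have "lp_pairing (u k) e = u k j" for k
    unfolding lp_pairing_def by (subst suminf_finite[of "{j}"]) (auto simp: e_def)
  moreover have "(\<lambda>k. lp_pairing (u k) e) \<longlonglongrightarrow> 0"
    using assms calculation(1) unfolding lp_weakly_null_def by blast
  ultimately show ?thesis by simp
qed

section \<open>Separated dual pairs with prescribed approximate values\<close>

text \<open>Let the weakly null unit vectors \<open>u\<^sub>k\<close> realise \<open>\<mu>\<close>. Both \<open>u\<^sub>k\<close> and \<open>J u\<^sub>k\<close> are perturbed by null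
  sequences, independently of each other, so as to satisfy the linear conditions \<open>G\<close> and \<open>F\<close>
  exactly. The pairing of the perturbed sequences tends to \<open>1\<close>; scaling one late pair makes it equal
  to \<open>1\<close> and the first norm equal to \<open>1\<close>, and this keeps the linear conditions.\<close>

lemma finitely_supported_dual_pair:
  assumes pq: "conjugate_exponents p q" and T: "lp_bounded_operator p T"
    and \<mu>: "\<mu> \<in> essential_numerical_range p q T" and \<delta>: "0 < \<delta>"
    and G: "finite G" "\<And>g. g \<in> G \<Longrightarrow> lp_functional p g"
    and F: "finite F" "F \<subseteq> lp p"
  shows "\<exists>u\<in>finite_support_from N. \<exists>v\<in>finite_support_from N.
           lp_norm p u = 1 \<and> lp_norm q v < 1 + \<delta> \<and> lp_pairing u v = 1 \<and>
           cmod (lp_pairing (T u) v - \<mu>) < \<delta> \<and>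
           (\<forall>g\<in>G. g u = 0) \<and> (\<forall>f\<in>F. lp_pairing f v = 0)"
proof -
  have e: "1 < p" "1 < q" using pq by (auto simp: conjugate_exponents_def)
  then have e1: "1 \<le> p" "1 \<le> q" "0 < p" "0 < q" by auto
  note qp = conjugate_exponents_sym[OF pq]
  obtain u where u: "\<And>k. u k \<in> lp p" "\<And>k. lp_norm p (u k) = 1" "lp_weakly_null q u"
    and lim: "(\<lambda>k. lp_pairing (T (u k)) (lp_duality_map p (u k))) \<longlonglongrightarrow> \<mu>"
    using \<mu> by (auto simp: essential_numerical_range_def)
  define w where "w k = lp_duality_map p (u k)" for k
  have w: "w k \<in> lp q" "lp_norm q (w k) = 1" "lp_pairing (u k) (w k) = 1" for k
    unfolding w_def using lp_duality_map_in_lp[OF pq u(1)] lp_duality_map_unit[OF pq u(1,2)] by auto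
  have w0: "(\<lambda>k. w k j) \<longlonglongrightarrow> 0" for j
  proof -
    have "(\<lambda>k. cmod (u k j) powr (p - 1)) \<longlonglongrightarrow> 0"
      using e weakly_null_coordinate[OF u(3), of j]
      by (intro tendsto_zero_powrI[where b = "p - 1"] tendsto_norm_zero) auto
    then have "(\<lambda>k. cmod (w k j)) \<longlonglongrightarrow> 0" by (simp add: w_def cmod_lp_duality_map)
    then show ?thesis by (rule tendsto_norm_zero_cancel)
  qed
  have "\<exists>u'. (\<forall>k. u' k \<in> finite_support_from N \<and> (\<forall>g\<in>G. g (u' k) = 0)) \<and>
              (\<lambda>k. lp_norm p (\<lambda>j. u' k j - u k j)) \<longlonglongrightarrow> 0"
    by (rule finitely_supported_perturbation_in_kernels[OF e1(1) u(1) weakly_null_coordinate[OF u(3)] G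
          weakly_null_functional[OF pq u(1,3) G(2)]])
  then obtain u' where u': "\<And>k. u' k \<in> finite_support_from N" "\<And>k g. g \<in> G \<Longrightarrow> g (u' k) = 0"
    and u'lim: "(\<lambda>k. lp_norm p (\<lambda>j. u' k j - u k j)) \<longlonglongrightarrow> 0" by blast
  define H where "H = (\<lambda>f z. lp_pairing z f) ` F"
  have "\<exists>w'. (\<forall>k. w' k \<in> finite_support_from N \<and> (\<forall>h\<in>H. h (w' k) = 0)) \<and>
              (\<lambda>k. lp_norm q (\<lambda>j. w' k j - w k j)) \<longlonglongrightarrow> 0"
  proof (rule finitely_supported_perturbation_in_kernels[OF e1(2) w(1) w0])
    show "finite H" using F by (simp add: H_def)
    fix h assume "h \<in> H"
    then obtain f where f: "f \<in> lp p" "h = (\<lambda>z. lp_pairing z f)" using F by (auto simp: H_def)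
    show "lp_functional q h" unfolding f(2) by (rule lp_functional_pairing[OF qp f(1)])
    show "(\<lambda>k. h (w k)) \<longlonglongrightarrow> 0"
      unfolding f(2) by (rule lp_pairing_coordinatewise_null[OF qp w(1) eq_refl[OF w(2)] w0 f(1)])
  qed
  then obtain w' where w': "\<And>k. w' k \<in> finite_support_from N" "\<And>k h. h \<in> H \<Longrightarrow> h (w' k) = 0"
    and w'lim: "(\<lambda>k. lp_norm q (\<lambda>j. w' k j - w k j)) \<longlonglongrightarrow> 0" by blast
  have w'F: "lp_pairing (w' k) f = 0" if "f \<in> F" for k f
    using w'(2)[of "\<lambda>z. lp_pairing z f" k] that by (simp add: H_def)
  have lp: "u' k \<in> lp p" "w' k \<in> lp q" for k
    using u'(1) w'(1) by (auto intro: finite_support_from_in_lp)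
  obtain C where C: "0 \<le> C" "\<And>x. x \<in> lp p \<Longrightarrow> lp_norm p (T x) \<le> C * lp_norm p x"
    using lp_bounded_operator_bound[OF T] by blast
  define a c d where "a k = lp_norm p (u' k)" and "c k = lp_pairing (u' k) (w' k)"
    and "d k = lp_pairing (T (u' k)) (w' k)" for k
  have a: "a \<longlonglongrightarrow> 1"
    unfolding a_def by (rule lp_norm_tendsto_perturbed[OF e1(1) u(1) lp(1) u(2) u'lim])
  have b: "(\<lambda>k. lp_norm q (w' k)) \<longlonglongrightarrow> 1"
    by (rule lp_norm_tendsto_perturbed[OF e1(2) w(1) lp(2) w(2) w'lim])
  have c: "c \<longlonglongrightarrow> 1"
    unfolding c_def
    by (rule lp_pairing_tendsto_perturbed[OF pq u(1) lp(1) w(1) lp(2) eq_refl[OF u(2)] eq_refl[OF w(2)] u'lim w'lim])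
      (simp add: w(3))
  have d: "d \<longlonglongrightarrow> \<mu>"
    unfolding d_def
  proof (rule lp_pairing_tendsto_perturbed[OF pq _ _ w(1) lp(2) _ eq_refl[OF w(2)] _ w'lim])
    show "T (u k) \<in> lp p" "T (u' k) \<in> lp p" for k by (intro lp_bounded_operator_in_lp[OF T] u lp)+
    show "lp_norm p (T (u k)) \<le> C" for k using C(2)[OF u(1)[of k]] by (simp add: u(2))
    show "(\<lambda>k. lp_pairing (T (u k)) (w k)) \<longlonglongrightarrow> \<mu>" using lim by (simp add: w_def)
    show "(\<lambda>k. lp_norm p (\<lambda>j. T (u' k) j - T (u k) j)) \<longlonglongrightarrow> 0"
    proof (rule Lim_null_comparison[OF always_eventually[OF allI]])
      show "norm (lp_norm p (\<lambda>j. T (u' k) j - T (u k) j)) \<le> C * lp_norm p (\<lambda>j. u' k j - u k j)" for k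
        using C(2)[OF lp_diff[OF e1(1) lp(1)[of k] u(1)[of k]]]
          lp_bounded_operator_diff[OF T e1(3) lp(1)[of k] u(1)[of k]] by simp
      show "(\<lambda>k. C * lp_norm p (\<lambda>j. u' k j - u k j)) \<longlonglongrightarrow> 0"
        by (rule tendsto_mult_right_zero[OF u'lim])
    qed
  qed
  have "\<forall>\<^sub>F k in sequentially. 0 < a k" using order_tendstoD(1)[OF a, of 0] by simp
  moreover have "\<forall>\<^sub>F k in sequentially. 0 < cmod (c k)"
    using order_tendstoD(1)[OF tendsto_norm[OF c], of 0] by simp
  moreover have "\<forall>\<^sub>F k in sequentially. a k / cmod (c k) * lp_norm q (w' k) < 1 + \<delta>"
    using order_tendstoD(2)[OF tendsto_mult[OF tendsto_divide[OF a tendsto_norm[OF c]] b], of "1 + \<delta>"] \<delta> by simp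
  moreover have "\<forall>\<^sub>F k in sequentially. dist (d k / c k) \<mu> < \<delta>"
    using tendstoD[OF tendsto_divide[OF d c] \<delta>] by simp
  ultimately have "\<forall>\<^sub>F k in sequentially. 0 < a k \<and> 0 < cmod (c k) \<and>
      a k / cmod (c k) * lp_norm q (w' k) < 1 + \<delta> \<and> dist (d k / c k) \<mu> < \<delta>"
    by eventually_elim blast
  then obtain k where k: "0 < a k" "c k \<noteq> 0" "a k / cmod (c k) * lp_norm q (w' k) < 1 + \<delta>"
      "dist (d k / c k) \<mu> < \<delta>"
    by (auto simp: eventually_sequentially)
  \<comment> \<open>Conjugated because the pairing is conjugate-linear in the second argument.\<close>
  define s where "s = cnj (of_real (a k) / c k)"
  define U V where "U = (\<lambda>j. of_real (1 / a k) * u' k j)" and "V = (\<lambda>j. s * w' k j)"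
  have UV: "U \<in> finite_support_from N" "V \<in> finite_support_from N"
    unfolding U_def V_def by (intro finite_support_from_scale u' w')+
  have V_lp: "V \<in> lp q" using UV(2) by (rule finite_support_from_in_lp)
  have pair_V: "lp_pairing z V = of_real (a k) / c k * lp_pairing z (w' k)" if "z \<in> lp p" for z
    unfolding V_def lp_pairing_scale_right[OF pq that lp(2)] by (simp add: s_def)
  have "lp_norm p U = 1"
    unfolding U_def lp_norm_scale[OF e1(3) lp(1)] using k(1) by (simp add: a_def norm_divide)
  moreover have "lp_norm q V < 1 + \<delta>"
    unfolding V_def lp_norm_scale[OF e1(4) lp(2)] using k(1,3) by (simp add: s_def norm_divide)
  moreover have "lp_pairing U V = 1"
    unfolding U_def lp_pairing_scale_left[OF pq lp(1) V_lp] pair_V[OF lp(1)]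
    using k(1,2) by (simp flip: c_def)
  moreover have "lp_pairing (T U) V = d k / c k"
    unfolding U_def lp_bounded_operator_scale[OF T lp(1)] 
      lp_pairing_scale_left[OF pq lp_bounded_operator_in_lp[OF T lp(1)] V_lp]
      pair_V[OF lp_bounded_operator_in_lp[OF T lp(1)]]
    using k(1,2) by (simp flip: d_def)
  moreover have "g U = 0" if "g \<in> G" for g
    unfolding U_def lp_functional_scale[OF G(2)[OF that] lp(1)] using u'(2)[OF that] by simp
  moreover have "lp_pairing f V = 0" if "f \<in> F" for f
    using that F(2) pair_V[of f] w'F[OF that, of k] lp_pairing_commute[OF qp lp(2), of f k] by auto
  ultimately show ?thesis using k(4) by (intro bexI[OF _ UV(1)] bexI[OF _ UV(2)]) (simp add: dist_norm)
qed

text \<open>The values \<open>\<langle>T u\<^sub>n, v\<^sub>n\<rangle>\<close> are only approximately prescribed, but all off-diagonal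
  entries vanish exactly: at stage \<open>n\<close> the supports are taken beyond those of the earlier pairs, \<open>u\<^sub>n\<close>
  is taken in the kernels of \<open>x \<mapsto> \<langle>T x, v\<^sub>m\<rangle>\<close>, and \<open>v\<^sub>n\<close> is taken to
  annihilate \<open>T u\<^sub>m\<close>, for all \<open>m < n\<close>.\<close>

lemma approximately_diagonal_system:
  assumes pq: "conjugate_exponents p q" and T: "lp_bounded_operator p T"
    and \<mu>: "\<And>n. \<mu> n \<in> essential_numerical_range p q T" and \<delta>: "\<And>n::nat. 0 < \<delta> n"
  obtains u v where
    "\<And>n. u n \<in> lp p" "\<And>n. v n \<in> lp q"
    "\<And>n. lp_norm p (u n) = 1" "\<And>n. lp_norm q (v n) < 1 + \<delta> n"
    "\<And>n. lp_pairing (u n) (v n) = 1" "\<And>n. cmod (lp_pairing (T (u n)) (v n) - \<mu> n) < \<delta> n"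
    "\<And>m n j. m \<noteq> n \<Longrightarrow> u m j \<noteq> 0 \<or> v m j \<noteq> 0 \<Longrightarrow> u n j = 0 \<and> v n j = 0"
    "\<And>m n. m \<noteq> n \<Longrightarrow> lp_pairing (T (u m)) (v n) = 0"
proof -
  define good where "good n u v \<longleftrightarrow> u \<in> finite_support_from 0 \<and> v \<in> finite_support_from 0 \<and>
      lp_norm p u = 1 \<and> lp_norm q v < 1 + \<delta> n \<and> lp_pairing u v = 1 \<and>
      cmod (lp_pairing (T u) v - \<mu> n) < \<delta> n" for n u v
  define sep where "sep w w' \<longleftrightarrow> (\<forall>j. fst w j \<noteq> 0 \<or> snd w j \<noteq> 0 \<longrightarrow> fst w' j = 0 \<and> snd w' j = 0) \<and>
      lp_pairing (T (fst w)) (snd w') = 0 \<and> lp_pairing (T (fst w')) (snd w) = 0" for w w'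
  define P where "P f n r \<longleftrightarrow> good n (fst r) (snd r) \<and> (\<forall>m<n. sep (f m) r)" for f n r
  have "\<exists>f. \<forall>n. P f n (f n)"
  proof (rule dependent_wellorder_choice)
    show "P f n r = P g n r" if "\<And>m. m < n \<Longrightarrow> f m = g m" for f g n r
      using that by (simp add: P_def)
  next
    fix n f
    assume *: "\<And>m. m < n \<Longrightarrow> P f m (f m)"
    have fs: "fst (f m) \<in> finite_support_from 0" "snd (f m) \<in> finite_support_from 0" if "m < n" for m
      using *[OF that] by (auto simp: P_def good_def)
    then have lp: "fst (f m) \<in> lp p" "snd (f m) \<in> lp q" if "m < n" for m
      using that by (auto intro: finite_support_from_in_lp)
    have "\<exists>M. \<forall>j. fst (f m) j \<noteq> 0 \<or> snd (f m) j \<noteq> 0 \<longrightarrow> j < M" if m: "m < n" for m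
    proof -
      obtain A B where "\<And>j. fst (f m) j \<noteq> 0 \<Longrightarrow> j < A" "\<And>j. snd (f m) j \<noteq> 0 \<Longrightarrow> j < B"
        using fs[OF m] unfolding finite_support_from_def by blast
      then show ?thesis by (intro exI[of _ "max A B"]) (auto simp: less_max_iff_disj)
    qed
    then obtain M where M: "\<And>m j. m < n \<Longrightarrow> fst (f m) j \<noteq> 0 \<or> snd (f m) j \<noteq> 0 \<Longrightarrow> j < M m"
      by metis
    define N where "N = (\<Sum>m<n. M m)"
    have N: "j < N" if "m < n" "fst (f m) j \<noteq> 0 \<or> snd (f m) j \<noteq> 0" for m j
    proof -
      have "M m \<le> N" unfolding N_def using that(1) by (intro member_le_sum) auto
      then show ?thesis using M[OF that] by simp
    qed
    define G where "G = (\<lambda>m x. lp_pairing (T x) (snd (f m))) ` {..<n}"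
    define F where "F = (\<lambda>m. T (fst (f m))) ` {..<n}"
    have "\<exists>u\<in>finite_support_from N. \<exists>v\<in>finite_support_from N.
           lp_norm p u = 1 \<and> lp_norm q v < 1 + \<delta> n \<and> lp_pairing u v = 1 \<and>
           cmod (lp_pairing (T u) v - \<mu> n) < \<delta> n \<and>
           (\<forall>g\<in>G. g u = 0) \<and> (\<forall>f\<in>F. lp_pairing f v = 0)"
    proof (rule finitely_supported_dual_pair[OF pq T \<mu> \<delta>])
      show "finite G" "finite F" by (simp_all add: G_def F_def)
      show "F \<subseteq> lp p" using lp lp_bounded_operator_in_lp[OF T] by (auto simp: F_def)
      show "lp_functional p g" if "g \<in> G" for g
        using that lp_functional_pairing_operator[OF pq T] lp by (auto simp: G_def)
    qed
    then obtain u v where u: "u \<in> finite_support_from N" and v: "v \<in> finite_support_from N"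
      and uv: "lp_norm p u = 1" "lp_norm q v < 1 + \<delta> n" "lp_pairing u v = 1"
         "cmod (lp_pairing (T u) v - \<mu> n) < \<delta> n"
      and G: "\<forall>g\<in>G. g u = 0" and F: "\<forall>f\<in>F. lp_pairing f v = 0" by blast
    have "u \<in> finite_support_from 0" "v \<in> finite_support_from 0"
      using u v by (auto simp: finite_support_from_def)
    then have "good n u v" using uv by (simp add: good_def)
    moreover have "sep (f m) (u, v)" if m: "m < n" for m
    proof -
      have "u j = 0 \<and> v j = 0" if "j < N" for j
        using u v that unfolding finite_support_from_def by (fastforce simp: not_le)
      then show ?thesis using G F m N[OF m] by (auto simp: sep_def G_def F_def)
    qed
    ultimately have "P f n (u, v)" by (simp add: P_def)
    then show "\<exists>r. P f n r" by blast
  qed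
  then obtain f where f: "\<And>n. P f n (f n)" by blast
  have g: "good n (fst (f n)) (snd (f n))" for n using f by (simp add: P_def)
  have s: "sep (f m) (f n)" if "m < n" for m n using f[of n] that by (simp add: P_def)
  show ?thesis
  proof (rule that[of "\<lambda>n. fst (f n)" "\<lambda>n. snd (f n)"])
    show "fst (f n) \<in> lp p" "snd (f n) \<in> lp q" for n
      using g[of n] by (auto simp: good_def intro: finite_support_from_in_lp)
    show "lp_norm p (fst (f n)) = 1" "lp_norm q (snd (f n)) < 1 + \<delta> n"
      "lp_pairing (fst (f n)) (snd (f n)) = 1"
      "cmod (lp_pairing (T (fst (f n))) (snd (f n)) - \<mu> n) < \<delta> n" for n
      using g[of n] by (auto simp: good_def)
    show "fst (f n) j = 0 \<and> snd (f n) j = 0" if "m \<noteq> n" "fst (f m) j \<noteq> 0 \<or> snd (f m) j \<noteq> 0" for m n j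
      using that s[of m n] s[of n m] by (cases "m < n") (auto simp: sep_def)
    show "lp_pairing (T (fst (f m))) (snd (f n)) = 0" if "m \<noteq> n" for m n
      using that s[of m n] s[of n m] by (cases "m < n") (auto simp: sep_def)
  qed
qed

section \<open>Finite combinations of disjointly supported sequences\<close>

lemma
  assumes p: "0 < p" and I: "finite I" and u: "\<And>i. i \<in> I \<Longrightarrow> u i \<in> lp p"
    and disj: "\<And>i k j. i \<in> I \<Longrightarrow> k \<in> I \<Longrightarrow> i \<noteq> k \<Longrightarrow> u i j \<noteq> 0 \<Longrightarrow> u k j = 0"
  shows lp_disjoint_sum: "(\<lambda>j. \<Sum>i\<in>I. u i j) \<in> lp p"
    and lp_norm_disjoint_sum: "lp_norm p (\<lambda>j. \<Sum>i\<in>I. u i j) powr p = (\<Sum>i\<in>I. lp_norm p (u i) powr p)"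
proof -
  have eq: "cmod (\<Sum>i\<in>I. u i j) powr p = (\<Sum>i\<in>I. cmod (u i j) powr p)" for j
  proof (cases "\<exists>i\<in>I. u i j \<noteq> 0")
    case True
    then obtain i where i: "i \<in> I" "u i j \<noteq> 0" by blast
    have "u k j = 0" if "k \<in> I - {i}" for k using disj[of i k j] i that by auto
    then show ?thesis using I i(1) by (simp add: sum.remove)
  qed simp
  have "(\<lambda>j. \<Sum>i\<in>I. cmod (u i j) powr p) sums (\<Sum>i\<in>I. lp_norm p (u i) powr p)"
    using u p by (intro sums_sum) (auto simp: lp_norm_powr lp_def summable_sums)
  then have s: "(\<lambda>j. cmod (\<Sum>i\<in>I. u i j) powr p) sums (\<Sum>i\<in>I. lp_norm p (u i) powr p)"
    by (simp add: eq)
  then show lp: "(\<lambda>j. \<Sum>i\<in>I. u i j) \<in> lp p" by (auto simp: lp_def sums_iff)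
  show "lp_norm p (\<lambda>j. \<Sum>i\<in>I. u i j) powr p = (\<Sum>i\<in>I. lp_norm p (u i) powr p)"
    using s lp_norm_powr[OF p lp] by (simp add: sums_iff)
qed

text \<open>With the \<open>p\<close>-th roots of convex weights as coefficients, a combination of disjointly supported
  unit vectors is again a unit vector. The same weights with \<open>q\<close>-th roots serve on the dual side, and
  the product of the two coefficients is the weight itself.\<close>

lemma
  assumes p: "0 < p" and I: "finite I" and u: "\<And>i. i \<in> I \<Longrightarrow> u i \<in> lp p"
    and disj: "\<And>i k j. i \<in> I \<Longrightarrow> k \<in> I \<Longrightarrow> i \<noteq> k \<Longrightarrow> u i j \<noteq> 0 \<Longrightarrow> u k j = 0"
    and t: "\<And>i. i \<in> I \<Longrightarrow> 0 \<le> t i"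
  shows lp_weighted_sum: "(\<lambda>j. \<Sum>i\<in>I. of_real (t i powr (1 / p)) * u i j) \<in> lp p"
    and lp_norm_weighted_sum: "lp_norm p (\<lambda>j. \<Sum>i\<in>I. of_real (t i powr (1 / p)) * u i j) =
       (\<Sum>i\<in>I. t i * lp_norm p (u i) powr p) powr (1 / p)"
proof -
  define w where "w i = (\<lambda>j. of_real (t i powr (1 / p)) * u i j)" for i
  have w: "w i \<in> lp p" if "i \<in> I" for i unfolding w_def by (rule lp_scale[OF p u[OF that]])
  have d: "w k j = 0" if "i \<in> I" "k \<in> I" "i \<noteq> k" "w i j \<noteq> 0" for i k j
    using disj[of i k j] that by (simp add: w_def)
  have n: "lp_norm p (w i) powr p = t i * lp_norm p (u i) powr p" if "i \<in> I" for i
    unfolding w_def lp_norm_scale[OF p u[OF that]] using t[OF that] p by (simp add: powr_mult powr_powr)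
  have *: "lp_norm p (\<lambda>j. \<Sum>i\<in>I. w i j) powr p = (\<Sum>i\<in>I. t i * lp_norm p (u i) powr p)"
    using lp_norm_disjoint_sum[OF p I w d] n by simp
  show "(\<lambda>j. \<Sum>i\<in>I. of_real (t i powr (1 / p)) * u i j) \<in> lp p"
    using lp_disjoint_sum[OF p I w d] by (simp add: w_def)
  show "lp_norm p (\<lambda>j. \<Sum>i\<in>I. of_real (t i powr (1 / p)) * u i j) =
       (\<Sum>i\<in>I. t i * lp_norm p (u i) powr p) powr (1 / p)"
    unfolding *[symmetric] using p by (simp add: powr_powr w_def)
qed

lemma lp_pairing_sum:
  assumes pq: "conjugate_exponents p q" and u: "\<And>i. i \<in> I \<Longrightarrow> u i \<in> lp p" and v: "\<And>k. k \<in> K \<Longrightarrow> v k \<in> lp q"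
  shows "lp_pairing (\<lambda>j. \<Sum>i\<in>I. a i * u i j) (\<lambda>j. \<Sum>k\<in>K. b k * v k j) =
    (\<Sum>i\<in>I. \<Sum>k\<in>K. a i * cnj (b k) * lp_pairing (u i) (v k))"
proof -
  have "(\<lambda>j. \<Sum>i\<in>I. \<Sum>k\<in>K. a i * cnj (b k) * (u i j * cnj (v k j))) sums
    (\<Sum>i\<in>I. \<Sum>k\<in>K. a i * cnj (b k) * lp_pairing (u i) (v k))"
    by (intro sums_sum sums_mult lp_pairing_sums[OF pq] u v)
  moreover have "(\<lambda>j. \<Sum>i\<in>I. \<Sum>k\<in>K. a i * cnj (b k) * (u i j * cnj (v k j))) =
    (\<lambda>j. (\<Sum>i\<in>I. a i * u i j) * cnj (\<Sum>k\<in>K. b k * v k j))"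
    by (simp add: sum_product cnj_sum mult_ac)
  ultimately show ?thesis by (simp add: lp_pairing_def sums_iff)
qed

lemma lp_bounded_operator_sum:
  assumes p: "1 \<le> p" and T: "lp_bounded_operator p T" and "finite I" and "\<And>i. i \<in> I \<Longrightarrow> u i \<in> lp p"
  shows "(\<lambda>j. \<Sum>i\<in>I. a i * u i j) \<in> lp p \<and>
    T (\<lambda>j. \<Sum>i\<in>I. a i * u i j) = (\<lambda>j. \<Sum>i\<in>I. a i * T (u i) j)"
  using assms(3,4)
proof (induction I)
  case empty
  then show ?case using lp_bounded_operator_scale[OF T lp_zero, of 0] by simp
next
  case (insert i I)
  have i: "u i \<in> lp p" "(\<lambda>j. a i * u i j) \<in> lp p"
    using insert.prems[of i] p by (auto intro: lp_scale)
  have IH: "(\<lambda>j. \<Sum>i\<in>I. a i * u i j) \<in> lp p"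
    "T (\<lambda>j. \<Sum>i\<in>I. a i * u i j) = (\<lambda>j. \<Sum>i\<in>I. a i * T (u i) j)"
    using insert.IH insert.prems by auto
  show ?case
    using insert.hyps lp_add[OF p i(2) IH(1)] lp_bounded_operator_add[OF T i(2) IH(1)]
    by (simp add: IH(2) lp_bounded_operator_scale[OF T i(1)])
qed

section \<open>Barycentric coordinates\<close>

text \<open>After the translation by \<open>l\<close> and scaling by \<open>\<rho>\<close>, three points \<open>b\<^sub>i = (x\<^sub>i, y\<^sub>i)\<close> of
  the plane satisfy \<open>(b\<^sub>1 \<times> b\<^sub>2) b\<^sub>0 + (b\<^sub>2 \<times> b\<^sub>0) b\<^sub>1 + (b\<^sub>0 \<times> b\<^sub>1) b\<^sub>2 = 0\<close>
  identically. For the points \<open>1\<close>, \<open>\<i>\<close> and \<open>- 1 - \<i>\<close> all three cross products are \<open>1\<close>, so they stay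
  positive for perturbations of size at most \<open>1/10\<close>, and normalising them gives the weights.\<close>

lemma barycentric_coordinates:
  fixes a0 a1 a2 l :: complex
  assumes \<rho>: "0 < \<rho>" and 0: "cmod (a0 - (l + of_real \<rho>)) < \<rho> / 10"
    and 1: "cmod (a1 - (l + of_real \<rho> * \<i>)) < \<rho> / 10"
    and 2: "cmod (a2 - (l + of_real \<rho> * (- 1 - \<i>))) < \<rho> / 10"
  obtains t0 t1 t2 :: real where "0 \<le> t0" "0 \<le> t1" "0 \<le> t2" "t0 + t1 + t2 = 1"
    "of_real t0 * a0 + of_real t1 * a1 + of_real t2 * a2 = l"
proof -
  define x0 y0 x1 y1 x2 y2 where
    "x0 = Re (a0 - l) / \<rho>" and "y0 = Im (a0 - l) / \<rho>" and
    "x1 = Re (a1 - l) / \<rho>" and "y1 = Im (a1 - l) / \<rho>" and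
    "x2 = Re (a2 - l) / \<rho>" and "y2 = Im (a2 - l) / \<rho>"
  note defs = this
  have near: "c - 1/10 < a / \<rho> \<and> a / \<rho> < c + 1/10" if "\<bar>a - c * \<rho>\<bar> < \<rho> / 10" for a c :: real
  proof -
    have "(c - 1/10) * \<rho> < a" "a < (c + 1/10) * \<rho>"
      using that unfolding abs_less_iff by (simp_all add: algebra_simps)
    then show ?thesis using \<rho> by (simp add: pos_less_divide_eq pos_divide_less_eq)
  qed
  have "\<bar>Re (a0 - l) - \<rho>\<bar> < \<rho> / 10" "\<bar>Im (a0 - l)\<bar> < \<rho> / 10"
    using abs_Re_le_cmod[of "a0 - (l + of_real \<rho>)"] abs_Im_le_cmod[of "a0 - (l + of_real \<rho>)"] 0
    by (auto simp: algebra_simps)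
  then have b0: "9/10 < x0" "x0 < 11/10" "-1/10 < y0" "y0 < 1/10"
    using near[of "Re (a0 - l)" "1"] near[of "Im (a0 - l)" "0"] by (simp_all add: defs)
  have "\<bar>Re (a1 - l)\<bar> < \<rho> / 10" "\<bar>Im (a1 - l) - \<rho>\<bar> < \<rho> / 10"
    using abs_Re_le_cmod[of "a1 - (l + of_real \<rho> * \<i>)"] abs_Im_le_cmod[of "a1 - (l + of_real \<rho> * \<i>)"] 1
    by (auto simp: algebra_simps)
  then have b1: "-1/10 < x1" "x1 < 1/10" "9/10 < y1" "y1 < 11/10"
    using near[of "Re (a1 - l)" "0"] near[of "Im (a1 - l)" "1"] by (simp_all add: defs)
  have "\<bar>Re (a2 - l) + \<rho>\<bar> < \<rho> / 10" "\<bar>Im (a2 - l) + \<rho>\<bar> < \<rho> / 10"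
    using abs_Re_le_cmod[of "a2 - (l + of_real \<rho> * (- 1 - \<i>))"]
      abs_Im_le_cmod[of "a2 - (l + of_real \<rho> * (- 1 - \<i>))"] 2
    by (auto simp: algebra_simps)
  then have b2: "-11/10 < x2" "x2 < -9/10" "-11/10 < y2" "y2 < -9/10"
    using near[of "Re (a2 - l)" "- 1"] near[of "Im (a2 - l)" "- 1"] by (simp_all add: defs)
  define s0 s1 s2 S where "s0 = x1 * y2 - x2 * y1" and "s1 = x2 * y0 - x0 * y2"
    and "s2 = x0 * y1 - x1 * y0" and "S = s0 + s1 + s2"
  have small: "- (11 / 100) \<le> a * b \<and> a * b \<le> 11 / 100"
    if "-1/10 \<le> a" "a \<le> 1/10" "-11/10 \<le> b" "b \<le> 11/10" for a b :: real
  proof -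
    have "\<bar>a\<bar> * \<bar>b\<bar> \<le> 1/10 * (11/10)" using that by (intro mult_mono) (auto simp: abs_le_iff)
    then have "\<bar>a * b\<bar> \<le> 11 / 100" by (simp add: abs_mult)
    then show ?thesis unfolding abs_le_iff by linarith
  qed
  have big: "81 / 100 \<le> a * b" if "9/10 \<le> a" "9/10 \<le> b" for a b :: real
    using mult_mono[of "9/10" a "9/10" b] that by simp
  have "0 < s0" using small[of x1 y2] big[of "- x2" y1] b1 b2 by (simp add: s0_def)
  moreover have "0 < s1" using small[of y0 x2] big[of x0 "- y2"] b0 b2 by (simp add: s1_def mult.commute)
  moreover have "0 < s2" using small[of x1 y0] big[of x0 y1] b0 b1 by (simp add: s2_def)
  ultimately have s: "0 < s0" "0 < s1" "0 < s2" "0 < S" by (auto simp: S_def)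
  have re: "s0 * x0 + s1 * x1 + s2 * x2 = 0" and im: "s0 * y0 + s1 * y1 + s2 * y2 = 0"
    by (simp_all add: s0_def s1_def s2_def algebra_simps)
  have a: "a0 = l + of_real \<rho> * Complex x0 y0" "a1 = l + of_real \<rho> * Complex x1 y1"
    "a2 = l + of_real \<rho> * Complex x2 y2"
    using \<rho> by (auto simp: defs complex_eq_iff)
  have "of_real s0 * Complex x0 y0 + of_real s1 * Complex x1 y1 + of_real s2 * Complex x2 y2 = 0"
    using re im by (simp add: complex_eq_iff)
  moreover have "of_real s0 * a0 + of_real s1 * a1 + of_real s2 * a2 = of_real S * l + of_real \<rho> *
      (of_real s0 * Complex x0 y0 + of_real s1 * Complex x1 y1 + of_real s2 * Complex x2 y2)"
    unfolding a S_def by (simp add: distrib_left distrib_right mult_ac add_ac)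
  ultimately have "of_real s0 * a0 + of_real s1 * a1 + of_real s2 * a2 = of_real S * l" by simp
  then have "of_real (s0 / S) * a0 + of_real (s1 / S) * a1 + of_real (s2 / S) * a2 = l"
    using s by (simp add: field_simps)
  moreover have "s0 / S + s1 / S + s2 / S = 1"
    using s by (simp add: S_def flip: add_divide_distrib)
  ultimately show ?thesis using that[of "s0 / S" "s1 / S" "s2 / S"] s by simp
qed

section \<open>Exact values by convex combination\<close>

theorem corollary3p7:
  fixes p q :: real
    and T :: "(nat \<Rightarrow> complex) \<Rightarrow> (nat \<Rightarrow> complex)"
    and l :: complex
    and \<epsilon> :: "nat \<Rightarrow> real"
  assumes "1 < p" and "1 / p + 1 / q = 1"
    and "lp_bounded_operator p T"
    and "l \<in> interior (essential_numerical_range p q T)"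
    and "\<And>n. 0 < \<epsilon> n"
  shows "\<exists>x x' :: nat \<Rightarrow> nat \<Rightarrow> complex.
           (\<forall>n. x n \<in> lp p \<and> x' n \<in> lp q \<and>
                lp_norm p (x n) = 1 \<and> lp_norm q (x' n) < 1 + \<epsilon> n) \<and>
           (\<forall>m n. lp_pairing (x n) (x' m) = (if n = m then 1 else 0) \<and>
                  lp_pairing (T (x n)) (x' m) = (if n = m then l else 0))"
proof -
  note T = assms(3)
  have pq: "conjugate_exponents p q" using conjugate_exponentsI assms(1,2) by blast
  then have e: "1 < p" "1 < q" "1 / p + 1 / q = 1" by (auto simp: conjugate_exponents_def)
  then have e0: "0 < p" "0 < q" "1 \<le> p" by auto
  obtain r where r: "0 < r" "ball l r \<subseteq> essential_numerical_range p q T"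
    using assms(4) by (auto simp: mem_interior)
  define \<rho> where "\<rho> = r / 2"
  have \<rho>: "0 < \<rho>" using r by (simp add: \<rho>_def)
  \<comment> \<open>The pairs \<open>3 n\<close>, \<open>3 n + 1\<close>, \<open>3 n + 2\<close> approximate the vertices of a triangle around \<open>l\<close>.
    Since \<open>\<bar>z i\<bar> < 2\<close>, it lies in the ball of radius \<open>r\<close>.\<close>
  define z :: "nat \<Rightarrow> complex" where "z i = (if i = 0 then 1 else if i = 1 then \<i> else - 1 - \<i>)" for i
  define \<mu> where "\<mu> k = l + of_real \<rho> * z (k mod 3)" for k
  define \<delta> where "\<delta> k = min (\<epsilon> (k div 3) / 2) (\<rho> / 10)" for k
  have z: "cmod (z i) < 2" for i
  proof -
    have "sqrt 2 < 2" by (rule real_less_lsqrt) auto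
    then show ?thesis by (auto simp: z_def cmod_def)
  qed
  have \<mu>: "\<mu> k \<in> essential_numerical_range p q T" for k
  proof -
    have "\<rho> * cmod (z (k mod 3)) < \<rho> * 2" using \<rho> z by (intro mult_strict_left_mono) auto
    then have "\<mu> k \<in> ball l r" using \<rho> by (simp add: \<mu>_def dist_norm norm_mult \<rho>_def)
    then show ?thesis using r by blast
  qed
  have \<delta>: "0 < \<delta> k" for k using assms(5) \<rho> by (simp add: \<delta>_def)
  obtain u v where
    u: "\<And>n. u n \<in> lp p" and v: "\<And>n. v n \<in> lp q" and
    nu: "\<And>n. lp_norm p (u n) = 1" and nv: "\<And>n. lp_norm q (v n) < 1 + \<delta> n" and
    uv: "\<And>n. lp_pairing (u n) (v n) = 1" and
    Tuv: "\<And>n. cmod (lp_pairing (T (u n)) (v n) - \<mu> n) < \<delta> n" and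
    disj: "\<And>m n j. m \<noteq> n \<Longrightarrow> u m j \<noteq> 0 \<or> v m j \<noteq> 0 \<Longrightarrow> u n j = 0 \<and> v n j = 0" and
    offdiag: "\<And>m n. m \<noteq> n \<Longrightarrow> lp_pairing (T (u m)) (v n) = 0"
  proof (rule approximately_diagonal_system[where \<mu> = \<mu> and \<delta> = \<delta>, OF pq T \<mu> \<delta>], goal_cases)
    case (1 u v)
    show ?case by (rule 1(1)[OF 1(2-9)])
  qed
  have uv0: "lp_pairing (u m) (v n) = 0" if "m \<noteq> n" for m n
  proof -
    have "(\<lambda>j. u m j * cnj (v n j)) = (\<lambda>j. 0)" using disj[OF that] by fastforce
    then show ?thesis by (simp add: lp_pairing_def)
  qed
  define \<alpha> where "\<alpha> k = lp_pairing (T (u k)) (v k)" for k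
  define I where "I n = {3 * n, 3 * n + 1, 3 * n + 2}" for n :: nat
  have "\<exists>t. (\<forall>k. 0 \<le> t k) \<and> (\<Sum>k\<in>I n. t k) = 1 \<and> (\<Sum>k\<in>I n. of_real (t k) * \<alpha> k) = l" for n
  proof -
    have le: "cmod (\<alpha> k - \<mu> k) < \<rho> / 10" for k using Tuv[of k]
      by (simp add: \<alpha>_def \<delta>_def)
    have "3 * n mod 3 = 0" "(3 * n + 1) mod 3 = 1" "(3 * n + 2) mod 3 = 2" by presburger+
    then have "\<mu> (3 * n) = l + of_real \<rho>" "\<mu> (3 * n + 1) = l + of_real \<rho> * \<i>"
      "\<mu> (3 * n + 2) = l + of_real \<rho> * (- 1 - \<i>)"
      by (simp_all add: \<mu>_def z_def)
    then have "cmod (\<alpha> (3 * n) - (l + of_real \<rho>)) < \<rho> / 10"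
      "cmod (\<alpha> (3 * n + 1) - (l + of_real \<rho> * \<i>)) < \<rho> / 10"
      "cmod (\<alpha> (3 * n + 2) - (l + of_real \<rho> * (- 1 - \<i>))) < \<rho> / 10"
      using le[of "3 * n"] le[of "3 * n + 1"] le[of "3 * n + 2"] by metis+
    from barycentric_coordinates[OF \<rho> this]
    obtain t0 t1 t2 where t: "0 \<le> t0" "0 \<le> t1" "0 \<le> t2" "t0 + t1 + t2 = 1"
      "of_real t0 * \<alpha> (3 * n) + of_real t1 * \<alpha> (3 * n + 1) + of_real t2 * \<alpha> (3 * n + 2) = l" by blast
    show ?thesis
      by (rule exI[of _ "\<lambda>k. if k = 3 * n then t0 else if k = 3 * n + 1 then t1 else t2"])
        (use t in \<open>simp add: I_def add.assoc\<close>)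
  qed
  then obtain t where t: "\<And>n k. 0 \<le> t n k" "\<And>n. (\<Sum>k\<in>I n. t n k) = 1"
    "\<And>n. (\<Sum>k\<in>I n. of_real (t n k) * \<alpha> k) = l" by metis
  have I: "finite (I n)" "i \<in> I n \<longleftrightarrow> i div 3 = n" for n i by (auto simp: I_def)
  define x where "x n = (\<lambda>j. \<Sum>k\<in>I n. of_real (t n k powr (1 / p)) * u k j)" for n
  define x' where "x' n = (\<lambda>j. \<Sum>k\<in>I n. of_real (t n k powr (1 / q)) * v k j)" for n
  \<comment> \<open>Terms with \<open>i \<noteq> k\<close> drop out, and \<open>1 / p + 1 / q = 1\<close> turns the product of the two roots of a
    weight into the weight.\<close>
  have diag: "(\<Sum>i\<in>I n. \<Sum>k\<in>I m. of_real (t n i powr (1 / p)) * cnj (of_real (t m k powr (1 / q))) * c i k) =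
      (if n = m then \<Sum>i\<in>I n. of_real (t n i) * c i i else 0)"
    if c: "\<And>i k. i \<noteq> k \<Longrightarrow> c i k = 0" for n m and c :: "nat \<Rightarrow> nat \<Rightarrow> complex"
  proof (cases "n = m")
    case True
    have "(\<Sum>k\<in>I n. of_real (t n i powr (1 / p)) * cnj (of_real (t n k powr (1 / q))) * c i k) = of_real (t n i) * c i i"
      if i: "i \<in> I n" for i
    proof -
      have "(\<Sum>k\<in>I n. of_real (t n i powr (1 / p)) * cnj (of_real (t n k powr (1 / q))) * c i k) =
        (\<Sum>k\<in>I n. if k = i then of_real (t n i powr (1 / p)) * of_real (t n i powr (1 / q)) * c i i else 0)"
        by (intro sum.cong) (auto simp: c)
      also have "\<dots> = of_real (t n i powr (1 / p) * t n i powr (1 / q)) * c i i"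
        using i I(1) by simp
      also have "t n i powr (1 / p) * t n i powr (1 / q) = t n i"
        unfolding powr_add[symmetric] e(3) using t(1) by simp
      finally show ?thesis .
    qed
    then show ?thesis using True by simp
  next
    case False
    then show ?thesis by (auto intro!: sum.neutral simp: c I(2))
  qed
  have "x n \<in> lp p" for n
    unfolding x_def by (rule lp_weighted_sum[OF e0(1) I(1) u _ t(1)]) (use disj in blast)
  moreover have "lp_norm p (x n) = 1" for n
  proof -
    have "lp_norm p (x n) = (\<Sum>k\<in>I n. t n k * lp_norm p (u k) powr p) powr (1 / p)"
      unfolding x_def by (rule lp_norm_weighted_sum[OF e0(1) I(1) u _ t(1)]) (use disj in blast)
    then show ?thesis by (simp add: nu t(2))
  qed
  moreover have "x' n \<in> lp q" for n
    unfolding x'_def by (rule lp_weighted_sum[OF e0(2) I(1) v _ t(1)]) (use disj in blast)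
  moreover have "lp_norm q (x' n) < 1 + \<epsilon> n" for n
  proof -
    define c where "c = 1 + \<epsilon> n / 2"
    have c: "0 < c" "c < 1 + \<epsilon> n" using assms(5)[of n] by (simp_all add: c_def)
    have "lp_norm q (v k) \<le> c" if "k \<in> I n" for k
      using nv[of k] that by (simp add: I(2) \<delta>_def c_def)
    then have "(\<Sum>k\<in>I n. t n k * lp_norm q (v k) powr q) \<le> (\<Sum>k\<in>I n. t n k * c powr q)"
      using e0 by (intro sum_mono mult_left_mono t powr_mono2) auto
    also have "\<dots> = c powr q" by (simp add: t(2) flip: sum_distrib_right)
    finally have "(\<Sum>k\<in>I n. t n k * lp_norm q (v k) powr q) powr (1 / q) \<le> (c powr q) powr (1 / q)"
      using e0 by (intro powr_mono2 sum_nonneg) (auto simp: t(1))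
    moreover have "lp_norm q (x' n) = (\<Sum>k\<in>I n. t n k * lp_norm q (v k) powr q) powr (1 / q)"
      unfolding x'_def by (rule lp_norm_weighted_sum[OF e0(2) I(1) v _ t(1)]) (use disj in blast)
    ultimately show ?thesis using c e0 by (simp add: powr_powr)
  qed
  moreover have "lp_pairing (x n) (x' m) = (if n = m then 1 else 0)" for m n
  proof -
    have "lp_pairing (x n) (x' m) = (if n = m then \<Sum>i\<in>I n. of_real (t n i) * lp_pairing (u i) (v i) else 0)"
      unfolding x_def x'_def lp_pairing_sum[OF pq u v] by (rule diag[OF uv0])
    then show ?thesis by (simp add: uv t(2) flip: of_real_sum)
  qed
  moreover have "lp_pairing (T (x n)) (x' m) = (if n = m then l else 0)" for m n
  proof -
    have Tx: "T (x n) = (\<lambda>j. \<Sum>k\<in>I n. of_real (t n k powr (1 / p)) * T (u k) j)"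
      unfolding x_def by (rule conjunct2[OF lp_bounded_operator_sum[OF e0(3) T I(1) u]])
    have "lp_pairing (T (x n)) (x' m) = (\<Sum>i\<in>I n. \<Sum>k\<in>I m.
        of_real (t n i powr (1 / p)) * cnj (of_real (t m k powr (1 / q))) * lp_pairing (T (u i)) (v k))"
      unfolding Tx x'_def by (rule lp_pairing_sum[OF pq lp_bounded_operator_in_lp[OF T u] v])
    also have "\<dots> = (if n = m then \<Sum>i\<in>I n. of_real (t n i) * \<alpha> i else 0)"
      unfolding \<alpha>_def by (rule diag[OF offdiag])
    finally show ?thesis by (simp add: t(3))
  qed
  ultimately show ?thesis by blast
qed

end
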